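(* Assume that $i_n$, $n\ge0$, are i.i.d. random variables uniformly distributed on $\{1,\dots,d\}$ (independent of $(g_n)$ and $Z_0$). Then for every $n\ge1$ the quadratic Wasserstein distance between the law of $X_n$ and $N(0,V)$ is at most $d/\sqrt n$; for every $n\ge0$, $$\sum_{j=0}^n E(\|M_j\|^2)\le d^2;$$ the sequence $\big(E(\|M_j\|^2)\big)_{j\ge0}$ is non-increasing; and for every $n\ge1$, $X_n$ is centered, $\mathrm{cov}(X_n)\le V$, and $$\operatorname{tr}\big(V-\mathrm{cov}(X_n)\big)\le \frac{d^2}{n}.$$
   Context: Let $d\ge1$ and let $V$ be a real symmetric positive semi-definite $d\times d$ matrix whose diagonal entries all equal $1$. Write $\sqrt V$ for its symmetric positive semi-definite square root and $I$ for the $d\times d$ identity matrix. Let $e_i$ be the $i$-th standard basis column vector of $\mathbb R^d$. Let $(i_n)_{n\ge0}$ be a sequence of indices in $\{1,\dots,d\}$. Let $(g_n)_{n\ge0}$ be i.i.d. standard Gaussian random variables, and let $Z_0$ be a $d$-dimensional vector of i.i.d. standard Gaussian random variables, with $(i_n)$, $(g_n)$ and $Z_0$ mutually independent. Define $X_0=0$ and $X_{n+1}=X_n+(g_n-e_{i_n}^TX_n)\,Ve_{i_n}$ for $n\ge0$. For $1\le i\le d$ let $f_i=\sqrt V e_i$ and $P_i=I-f_if_i^T$. For $0\le m\le n$ let $M_{m,n}=P_{i_{n-1}}P_{i_{n-2}}\cdots P_{i_m}$ with $M_{n,n}=I$, and $M_n=M_{0,n}$. For a $d\times d$ matrix $A$,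 $\|A\|=\sqrt{\operatorname{tr}(A^TVA)}$; for a vector $x$, $\|x\|$ is its Euclidean norm. For a centered random vector $Z$ with finite second moments, $\mathrm{cov}(Z)=E(ZZ^T)$. For symmetric matrices, $A\le B$ means $B-A$ is positive semi-definite. The quadratic Wasserstein distance between probability measures $\mu,\mu'$ on $\mathbb R^d$ is $\mathcal W_2(\mu,\mu')=\big(\inf E\|Y-Y'\|^2\big)^{1/2}$, the infimum over all couplings with $Y\sim\mu$, $Y'\sim\mu'$. *)

theory Defs
  imports "HOL-Analysis.Analysis" "HOL-Probability.Probability"
begin

definition psd_matrix :: "real^'d^'d \<Rightarrow> bool" where
  "psd_matrix S \<longleftrightarrow> transpose S = S \<and> (\<forall>x. 0 \<le> x \<bullet> (S *v x))"

definition loewner_le :: "real^'d^'d \<Rightarrow> real^'d^'d \<Rightarrow> bool" where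
  "loewner_le A B \<longleftrightarrow> psd_matrix (B - A)"

definition msqrt :: "real^'d^'d \<Rightarrow> real^'d^'d" where
  "msqrt V = (THE S. psd_matrix S \<and> S ** S = V)"

definition outer :: "real^'d \<Rightarrow> real^'d \<Rightarrow> real^'d^'d" where
  "outer x y = (\<chi> a b. x $ a * y $ b)"

definition fvec :: "real^'d^'d \<Rightarrow> 'd \<Rightarrow> real^'d" where
  "fvec V k = msqrt V *v axis k 1"

definition Pmat :: "real^'d^'d \<Rightarrow> 'd \<Rightarrow> real^'d^'d" where
  "Pmat V k = mat 1 - outer (fvec V k) (fvec V k)"

text \<open>M_n = P_{i_{n-1}} ... P_{i_0}, M_0 = I (for a fixed realisation ii of the index sequence).\<close>
primrec Mseq :: "real^'d^'d \<Rightarrow> (nat \<Rightarrow> 'd) \<Rightarrow> nat \<Rightarrow> real^'d^'d" where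
  "Mseq V ii 0 = mat 1"
| "Mseq V ii (Suc n) = Pmat V (ii n) ** Mseq V ii n"

text \<open>X_0 = 0, X_{n+1} = X_n + (g_n - e_{i_n}^T X_n) V e_{i_n} (for fixed realisations ii, gg).\<close>
primrec Xseq :: "real^'d^'d \<Rightarrow> (nat \<Rightarrow> 'd) \<Rightarrow> (nat \<Rightarrow> real) \<Rightarrow> nat \<Rightarrow> real^'d" where
  "Xseq V ii gg 0 = 0"
| "Xseq V ii gg (Suc n) = Xseq V ii gg n + (gg n - axis (ii n) 1 \<bullet> Xseq V ii gg n) *s (V *v axis (ii n) 1)"

definition mnorm2 :: "real^'d^'d \<Rightarrow> real^'d^'d \<Rightarrow> real" where
  "mnorm2 V A = trace (transpose A ** V ** A)"

definition cov_mat :: "'a measure \<Rightarrow> ('a \<Rightarrow> real^'d) \<Rightarrow> real^'d^'d" where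
  "cov_mat M Z = (\<chi> a b. integral\<^sup>L M (\<lambda>\<omega>. Z \<omega> $ a * Z \<omega> $ b))"

definition gaussian_measure :: "real^'d^'d \<Rightarrow> (real^'d) measure" where
  "gaussian_measure V =
     distr (\<Pi>\<^sub>M k\<in>(UNIV::'d set). density lborel std_normal_density) borel
           (\<lambda>z. msqrt V *v (\<chi> k. z k))"

definition couplings :: "(real^'d) measure \<Rightarrow> (real^'d) measure \<Rightarrow> ((real^'d) \<times> (real^'d)) measure set" where
  "couplings \<mu> \<mu>' = {\<nu>. prob_space \<nu> \<and> sets \<nu> = sets (borel \<Otimes>\<^sub>M borel) \<and>
       distr \<nu> borel fst = \<mu> \<and> distr \<nu> borel snd = \<mu>'}"

definition ennsqrt :: "ennreal \<Rightarrow> ennreal" where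
  "ennsqrt x = (if x = \<infinity> then \<infinity> else ennreal (sqrt (enn2real x)))"

definition wasserstein2 :: "(real^'d) measure \<Rightarrow> (real^'d) measure \<Rightarrow> ennreal" where
  "wasserstein2 \<mu> \<mu>' =
     ennsqrt (INF \<nu>\<in>couplings \<mu> \<mu>'. \<integral>\<^sup>+ p. ennreal ((norm (fst p - snd p))\<^sup>2) \<partial>\<nu>)"

end

theory Submission
  imports Defs
begin

text \<open>
  Write \<open>X\<^sub>n = \<surd>V Y\<^sub>n\<close>, so that \<open>Y\<^sub>n\<^sub>+\<^sub>1 = P Y\<^sub>n + g\<^sub>n f\<close> for the chosen direction
  \<open>f\<close>: the coordinate of \<open>Y\<^sub>n\<close> along \<open>f\<close> is resampled. The standard Gaussian law is invariant under
  this update, so the same chain started at \<open>Z\<^sub>0\<close> stays standard Gaussian, and it differs from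
  \<open>Y\<^sub>n\<close> by \<open>M\<^sub>n Z\<^sub>0\<close>.

  With \<open>T A = d\<^sup>-\<^sup>1 \<Sum>\<^sub>k P\<^sub>k A P\<^sub>k\<close>, the matrices \<open>E (M\<^sub>n M\<^sub>n\<^sup>T)\<close> and \<open>I - cov Y\<^sub>n\<close>, as well as the second
  moment of \<open>M\<^sub>n Z\<^sub>0\<close>, all equal \<open>T\<^sup>n I\<close>; hence the three quantities to be bounded are
  \<open>a\<^sub>n = tr (V T\<^sup>n I)\<close>. Since the \<open>f\<^sub>k f\<^sub>k\<^sup>T\<close> add up to \<open>V\<close>, \<open>T I = I - V / d\<close>. So \<open>T\<^sup>n I\<close> decreases,
  which makes \<open>a\<^sub>n\<close> non-increasing, and, \<open>T\<close> being self-adjoint for the trace,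
  \<open>a\<^sub>n = d tr (T\<^sup>n I - T\<^sup>n\<^sup>+\<^sup>1 I)\<close> telescopes to a sum of at most \<open>d\<^sup>2\<close>.
\<close>


subsection \<open>The positive semi-definite square root\<close>

lemma inner_symmetric_matrix:
  fixes A :: "real^'n^'n"
  assumes "transpose A = A"
  shows "x \<bullet> (A *v y) = (A *v x) \<bullet> y"
  by (metis assms dot_lmul_matrix transpose_matrix_vector)

text \<open>A zero of a non-negative quadratic form is a minimum: if \<open>B *v u\<close> were
  non-zero, a small move from \<open>u\<close> against it would make the form negative to first
  order. Non-negativity is asked for on an invariant subspace only, which is the situation of a
  Rayleigh quotient maximised there.\<close>

lemma psd_form_null_vector:
  fixes B :: "real^'n^'n"
  assumes W: "subspace W" and inv: "\<And>x. x \<in> W \<Longrightarrow> B *v x \<in> W"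
    and sym: "transpose B = B" and psd: "\<And>x. x \<in> W \<Longrightarrow> 0 \<le> x \<bullet> (B *v x)"
    and u: "u \<in> W" "u \<bullet> (B *v u) = 0"
  shows "B *v u = 0"
proof (rule ccontr)
  define v where "v = B *v u"
  define q where "q = v \<bullet> (B *v v)"
  define s where "s = v \<bullet> v"
  \<comment> \<open>The form at \<open>u - t *\<^sub>R v\<close> equals
    \<open>t * (t * q - 2 * s)\<close>. This \<open>t\<close> gives \<open>t * q \<le> s\<close>,
    hence a negative value, and the \<open>+ 1\<close> covers the case \<open>q = 0\<close>.\<close>
  define t where "t = s / (q + 1)"
  assume "B *v u \<noteq> 0"
  then have s: "s > 0" by (simp add: s_def v_def)
  have v: "v \<in> W" using inv u by (simp add: v_def)
  then have q: "q \<ge> 0" using psd by (simp add: q_def)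
  have "u - t *\<^sub>R v \<in> W" using W u v by (simp add: subspace_diff subspace_scale)
  then have "0 \<le> (u - t *\<^sub>R v) \<bullet> (B *v (u - t *\<^sub>R v))" by (rule psd)
  also have "\<dots> = u \<bullet> (B *v u) - t * (u \<bullet> (B *v v)) - t * (v \<bullet> (B *v u)) + t\<^sup>2 * q"
    by (simp add: matrix_vector_mult_diff_distrib inner_diff_left inner_diff_right q_def
        power2_eq_square algebra_simps matrix_vector_mult_scaleR)
  also have "u \<bullet> (B *v v) = s" by (simp add: inner_symmetric_matrix[OF sym] v_def s_def)
  also have "v \<bullet> (B *v u) = s" by (simp add: v_def s_def)
  finally have "0 \<le> t * (t * q - 2 * s)" using u by (simp add: algebra_simps power2_eq_square)
  moreover have "t > 0" using s q by (simp add: t_def)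
  moreover have "t * q \<le> s"
    using s q by (simp add: t_def divide_simps)
  ultimately show False using s by (simp add: zero_le_mult_iff)
qed

text \<open>A maximiser \<open>u\<close> of the quadratic form on the compact unit sphere of
  \<open>W\<close> works: with \<open>c\<close> the maximum, the form of
  \<open>c *\<^sub>R mat 1 - A\<close> is non-negative on \<open>W\<close> and vanishes at
  \<open>u\<close>, so \<open>u\<close> lies in its kernel.\<close>

lemma symmetric_matrix_eigenvector:
  fixes A :: "real^'n^'n"
  assumes W: "subspace W" "W \<noteq> {0}" and inv: "\<And>x. x \<in> W \<Longrightarrow> A *v x \<in> W"
    and sym: "transpose A = A"
  obtains u c where "u \<in> W" "norm u = 1" "A *v u = c *\<^sub>R u"
proof -
  obtain w where w: "w \<in> W" "w \<noteq> 0" using W subspace_0 by blast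
  then have "w /\<^sub>R norm w \<in> W \<inter> sphere 0 1" using W by (simp add: subspace_scale)
  then have ne: "W \<inter> sphere 0 1 \<noteq> {}" by blast
  have "compact (W \<inter> sphere 0 1)" using W by (simp add: closed_Int_compact closed_subspace)
  moreover have "continuous_on (W \<inter> sphere 0 1) (\<lambda>x. x \<bullet> (A *v x))"
    by (intro continuous_intros linear_continuous_on linear_linear[THEN iffD2] matrix_vector_mul_linear)
  ultimately obtain u where u: "u \<in> W" "norm u = 1"
    and max: "\<And>y. y \<in> W \<Longrightarrow> norm y = 1 \<Longrightarrow> y \<bullet> (A *v y) \<le> u \<bullet> (A *v u)"
    using continuous_attains_sup[of "W \<inter> sphere 0 1" "\<lambda>x. x \<bullet> (A *v x)"] ne by force
  define c where "c = u \<bullet> (A *v u)"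
  let ?B = "c *\<^sub>R mat 1 - A"
  have B: "?B *v x = c *\<^sub>R x - A *v x" for x
    by (simp add: matrix_vector_mult_diff_rdistrib scaleR_matrix_vector_assoc[symmetric])
  have "?B *v u = 0"
  proof (rule psd_form_null_vector[OF W(1)])
    show "?B *v x \<in> W" if "x \<in> W" for x
      using that W inv by (simp add: B subspace_diff subspace_scale)
    show "transpose ?B = ?B"
      using sym by (simp add: vec_eq_iff transpose_def mat_def)
    show "0 \<le> x \<bullet> (?B *v x)" if x: "x \<in> W" for x
    proof (cases "x = 0")
      case False
      have "(x /\<^sub>R norm x) \<bullet> (A *v (x /\<^sub>R norm x)) \<le> c"
        unfolding c_def using False x W by (intro max) (auto simp: subspace_scale)
      then have "(x \<bullet> (A *v x)) / (norm x)\<^sup>2 \<le> c"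
        by (simp add: matrix_vector_mult_scaleR power2_eq_square divide_simps)
      then have "x \<bullet> (A *v x) \<le> c * (x \<bullet> x)"
        using False by (simp add: divide_le_eq dot_square_norm)
      then show ?thesis by (simp add: B inner_diff_right)
    qed simp
    show "u \<bullet> (?B *v u) = 0"
      unfolding B using u by (simp add: inner_diff_right c_def dot_square_norm)
  qed (use u in auto)
  then show thesis using u by (intro that[of u c]) (auto simp: B)
qed

lemma outer_mult_vec: "outer x y *v z = (y \<bullet> z) *\<^sub>R x"
  by (simp add: outer_def vec_eq_iff matrix_vector_mult_def inner_vec_def sum_distrib_left mult_ac)

lemma transpose_outer: "transpose (outer x y) = outer y x"
  by (simp add: outer_def vec_eq_iff transpose_def)

lemma transpose_add: "transpose (A + B) = transpose A + transpose (B :: real^'n^'m)"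
  by (simp add: vec_eq_iff transpose_def)

lemma transpose_diff: "transpose (A - B) = transpose A - transpose (B :: real^'n^'m)"
  by (simp add: vec_eq_iff transpose_def)

lemma transpose_scaleR: "transpose (c *\<^sub>R A) = c *\<^sub>R transpose (A :: real^'n^'m)"
  by (simp add: vec_eq_iff transpose_def)

text \<open>Splitting off one eigenvector at a time, so that no eigenbasis has to be handled.\<close>

lemma psd_sqrt_on_invariant_subspace:
  fixes A :: "real^'n^'n"
  assumes A: "psd_matrix A"
  shows "subspace W \<Longrightarrow> (\<And>x. x \<in> W \<Longrightarrow> A *v x \<in> W) \<Longrightarrow>
    \<exists>S. psd_matrix S \<and> (\<forall>x. S *v x \<in> W) \<and> (\<forall>x\<in>W. S *v (S *v x) = A *v x)"
proof (induction "dim W" arbitrary: W rule: less_induct)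
  case less
  note W = less.prems
  have sym: "transpose A = A" using A by (simp add: psd_matrix_def)
  show ?case
  proof (cases "W = {0}")
    case True
    have "transpose 0 = (0::real^'n^'n)" by (simp add: vec_eq_iff transpose_def)
    then show ?thesis using True by (intro exI[of _ 0]) (auto simp: psd_matrix_def)
  next
    case False
    then obtain u c where u: "u \<in> W" "norm u = 1" "A *v u = c *\<^sub>R u"
      using symmetric_matrix_eigenvector W sym by blast
    then have uu: "u \<bullet> u = 1" by (simp add: dot_square_norm)
    have c: "c \<ge> 0" using A u uu by (simp add: psd_matrix_def) (metis inner_scaleR_right mult_1_right)
    \<comment> \<open>The orthogonal complement of the eigenvector inside \<open>W\<close>; it is
      again invariant because \<open>A\<close> is symmetric, and its dimension is smaller.\<close>
    define W' where "W' = W \<inter> {x. u \<bullet> x = 0}"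
    have W': "subspace W'" unfolding W'_def by (intro subspace_inter W subspace_hyperplane)
    have "u \<notin> W'" using uu by (simp add: W'_def)
    then have "W' \<subset> W" using u(1) unfolding W'_def by blast
    then have "dim W' < dim W" using W' W by (metis dim_psubset span_eq_iff)
    moreover have "A *v x \<in> W'" if "x \<in> W'" for x
      using that W u by (auto simp: W'_def inner_symmetric_matrix[OF sym])
    ultimately obtain S where S: "psd_matrix S" "\<And>x. S *v x \<in> W'"
      "\<And>x. x \<in> W' \<Longrightarrow> S *v (S *v x) = A *v x"
      using less.hyps[of W'] W' by blast
    then have symS: "transpose S = S" by (simp add: psd_matrix_def)
    \<comment> \<open>The induction provides an \<open>S\<close> that maps the whole space into
      \<open>W'\<close>, so its range is orthogonal to \<open>u\<close>. Symmetry turns this into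
      \<open>S *v u = 0\<close>, and adding \<open>sqrt c\<close> along \<open>u\<close> does not
      interfere with \<open>S\<close>.\<close>
    have uS: "u \<bullet> (S *v x) = 0" for x using S(2)[of x] by (simp add: W'_def)
    have Su: "S *v u = 0"
      using uS[of "S *v u"] by (simp add: inner_symmetric_matrix[OF symS, of u])
    define R where "R = S + sqrt c *\<^sub>R outer u u"
    have R: "R *v x = S *v x + (sqrt c * (u \<bullet> x)) *\<^sub>R u" for x
      by (simp add: R_def matrix_vector_mult_add_rdistrib scaleR_matrix_vector_assoc[symmetric]
          outer_mult_vec)
    have "psd_matrix R"
    proof -
      have "transpose R = R"
        using symS by (simp add: R_def transpose_add transpose_scaleR transpose_outer)
      moreover have "0 \<le> x \<bullet> (R *v x)" for x
      proof -
        have "x \<bullet> (R *v x) = x \<bullet> (S *v x) + sqrt c * (u \<bullet> x)\<^sup>2"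
          by (simp add: R inner_add_right inner_commute power2_eq_square)
        then show ?thesis using S(1) c by (simp add: psd_matrix_def)
      qed
      ultimately show ?thesis by (simp add: psd_matrix_def)
    qed
    moreover have "R *v x \<in> W" for x
      using S(2)[of x] u W by (simp add: R W'_def subspace_add subspace_scale)
    moreover have "R *v (R *v x) = A *v x" if x: "x \<in> W" for x
    proof -
      define y where "y = x - (u \<bullet> x) *\<^sub>R u"
      have y: "y \<in> W'" using x u W uu
        by (simp add: y_def W'_def subspace_diff subspace_scale inner_diff_right)
      have xy: "x = y + (u \<bullet> x) *\<^sub>R u" by (simp add: y_def)
      have Sx: "S *v x = S *v y"
        by (subst xy) (simp add: matrix_vector_right_distrib matrix_vector_mult_scaleR Su)
      have "R *v (R *v x) = S *v (S *v y) + (c * (u \<bullet> x)) *\<^sub>R u"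
        using c by (simp add: R Sx matrix_vector_right_distrib matrix_vector_mult_scaleR Su uS
            inner_add_right uu mult.assoc[symmetric])
      also have "\<dots> = A *v x"
        by (subst (2) xy) (simp add: S(3)[OF y] matrix_vector_right_distrib
            matrix_vector_mult_scaleR u mult.commute)
      finally show ?thesis .
    qed
    ultimately show ?thesis by blast
  qed
qed

text \<open>The difference \<open>D = S - R\<close> satisfies \<open>S ** D + D ** R = 0\<close>.
  Tested at an eigenvector \<open>u\<close> of \<open>D\<close> with eigenvalue \<open>c\<close>,
  this reads \<open>c * (u \<bullet> (S *v u) + u \<bullet> (R *v u)) = 0\<close>. So either
  \<open>c = 0\<close>, or both forms vanish and \<open>S\<close>, \<open>R\<close> both annihilate
  \<open>u\<close>; in each case \<open>D *v u = 0\<close>.\<close>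

lemma psd_sqrt_unique:
  fixes S R :: "real^'n^'n"
  assumes S: "psd_matrix S" and R: "psd_matrix R" and eq: "S ** S = R ** R"
  shows "S = R"
proof -
  define D where "D = S - R"
  define W where "W = range (\<lambda>x. D *v x)"
  have symS: "transpose S = S" and symR: "transpose R = R"
    using S R by (auto simp: psd_matrix_def)
  have symD: "transpose D = D" by (simp add: D_def transpose_diff symS symR)
  have D: "D *v x = S *v x - R *v x" for x
    by (simp add: D_def matrix_vector_mult_diff_rdistrib)
  have W: "subspace W"
    unfolding W_def by (intro linear_subspace_image subspace_UNIV matrix_vector_mul_linear)
  have "W = {0}"
  proof (rule ccontr)
    assume "W \<noteq> {0}"
    moreover have "D *v x \<in> W" for x by (simp add: W_def)
    ultimately obtain u c where u: "u \<in> W" "norm u = 1" "D *v u = c *\<^sub>R u"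
      using symmetric_matrix_eigenvector[OF W] symD by blast
    have "S *v (D *v u) + D *v (R *v u) = 0"
    proof -
      have "S *v (S *v u) = R *v (R *v u)" by (simp add: matrix_vector_mul_assoc eq)
      then show ?thesis unfolding D matrix_vector_mult_diff_distrib by simp
    qed
    then have "u \<bullet> (S *v (D *v u)) + u \<bullet> (D *v (R *v u)) = 0"
      by (metis inner_add_right inner_zero_right)
    then have "c * (u \<bullet> (S *v u) + u \<bullet> (R *v u)) = 0"
      by (simp add: inner_symmetric_matrix[OF symD, of u] u matrix_vector_mult_scaleR algebra_simps)
    moreover have "c = 0" if "u \<bullet> (S *v u) + u \<bullet> (R *v u) = 0"
    proof -
      have "u \<bullet> (S *v u) = 0" "u \<bullet> (R *v u) = 0"
        using that S R unfolding psd_matrix_def by (metis add_nonneg_eq_0_iff)+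
      then have "S *v u = 0" "R *v u = 0"
        using psd_form_null_vector[of UNIV S u] psd_form_null_vector[of UNIV R u] S R
        by (auto simp: psd_matrix_def)
      then have "c *\<^sub>R u = 0" using u(3) by (simp add: D)
      then show "c = 0" using u by auto
    qed
    ultimately have "D *v u = 0" using u by auto
    \<comment> \<open>The eigenvector was sought in the range of \<open>D\<close> for this reason:
      by symmetry \<open>u \<bullet> u = (D *v u) \<bullet> z = 0\<close>.\<close>
    moreover obtain z where "u = D *v z" using u by (auto simp: W_def)
    ultimately have "u \<bullet> u = 0" by (simp add: inner_symmetric_matrix[OF symD])
    then show False using u by simp
  qed
  then have "D *v x = 0" for x by (auto simp: W_def)
  then show ?thesis by (simp add: D matrix_eq)
qed

text \<open>Existence on the full space together with uniqueness makes the \<open>THE\<close> in the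
  definition of \<open>msqrt\<close> meaningful.\<close>

lemma msqrt:
  assumes "psd_matrix V"
  shows psd_msqrt: "psd_matrix (msqrt V)" and msqrt_square: "msqrt V ** msqrt V = V"
proof -
  obtain S where S: "psd_matrix S" "\<And>x. S *v (S *v x) = V *v x"
    using psd_sqrt_on_invariant_subspace[OF assms, of UNIV] by auto
  then have "S ** S = V" by (simp add: matrix_eq matrix_vector_mul_assoc[symmetric])
  then have "\<exists>!S. psd_matrix S \<and> S ** S = V" using S psd_sqrt_unique by metis
  from theI'[OF this] show "psd_matrix (msqrt V)" "msqrt V ** msqrt V = V"
    by (auto simp: msqrt_def)
qed

subsection \<open>The standard Gaussian law on a Euclidean space\<close>

text \<open>As in the uniqueness proof for Haar measure: only translation invariance and one
  rotation-invariant set of positive finite measure are used.\<close>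

lemma nn_integral_lborel_orthogonal:
  fixes R :: "'a::euclidean_space \<Rightarrow> 'a" and h :: "'a \<Rightarrow> ennreal"
  assumes R: "orthogonal_transformation R" and [measurable]: "h \<in> borel_measurable borel"
  shows "(\<integral>\<^sup>+x. h (R x) \<partial>lborel) = (\<integral>\<^sup>+x. h x \<partial>lborel)"
proof -
  have lin: "linear R" using R by (rule orthogonal_transformation_linear)
  have [measurable]: "R \<in> borel_measurable borel"
    using lin by (intro borel_measurable_continuous_onI linear_continuous_on linear_linear[THEN iffD2])
  define B where "B = (indicator (ball 0 1) :: 'a \<Rightarrow> ennreal)"
  have [measurable]: "B \<in> borel_measurable borel" unfolding B_def by (intro borel_measurable_indicator) simp
  have BR: "B (- R x) = B x" for x
    using R by (simp add: B_def indicator_def orthogonal_transformation)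
  have tr: "(\<integral>\<^sup>+x. k (x + c) \<partial>lborel) = (\<integral>\<^sup>+x. k x \<partial>lborel)"
    if [measurable]: "k \<in> borel_measurable borel" for k :: "'a \<Rightarrow> ennreal" and c
    by (subst (2) lborel_distr_plus[of c, symmetric]) (simp add: nn_integral_distr add.commute)
  \<comment> \<open>Translating \<open>x\<close> by \<open>inv R y\<close> shifts \<open>R x\<close>
    by \<open>y\<close>. Below, such a translation turns \<open>h (R x)\<close> into
    \<open>h (R x + y)\<close>, a translation of \<open>y\<close> then moves \<open>R x\<close> from
    \<open>h\<close> into \<open>B\<close>, and a last translation of \<open>x\<close> removes
    \<open>y\<close> from \<open>B\<close>; Fubini exchanges the variables in between.\<close>
  have RR: "R (x + inv R y) = R x + y" for x y
    using R lin by (simp add: linear_add orthogonal_transformation_surj surj_f_inv_f)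
  have "(\<integral>\<^sup>+y. B y \<partial>lborel) * (\<integral>\<^sup>+x. h (R x) \<partial>lborel) = (\<integral>\<^sup>+y. (\<integral>\<^sup>+x. B y * h (R x) \<partial>lborel) \<partial>lborel)"
    by (simp add: nn_integral_cmult nn_integral_multc)
  also have "\<dots> = (\<integral>\<^sup>+y. (\<integral>\<^sup>+x. B y * h (R x + y) \<partial>lborel) \<partial>lborel)"
  proof (rule nn_integral_cong)
    fix y
    show "(\<integral>\<^sup>+x. B y * h (R x) \<partial>lborel) = (\<integral>\<^sup>+x. B y * h (R x + y) \<partial>lborel)"
      using tr[of "\<lambda>x. B y * h (R x)" "inv R y"] by (simp add: RR)
  qed
  also have "\<dots> = (\<integral>\<^sup>+x. (\<integral>\<^sup>+y. B y * h (R x + y) \<partial>lborel) \<partial>lborel)"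
    by (rule lborel_pair.Fubini') simp
  also have "\<dots> = (\<integral>\<^sup>+x. (\<integral>\<^sup>+y. B (y - R x) * h y \<partial>lborel) \<partial>lborel)"
  proof (rule nn_integral_cong)
    fix x
    show "(\<integral>\<^sup>+y. B y * h (R x + y) \<partial>lborel) = (\<integral>\<^sup>+y. B (y - R x) * h y \<partial>lborel)"
      using tr[of "\<lambda>y. B (y - R x) * h y" "R x"] by (simp add: add.commute)
  qed
  also have "\<dots> = (\<integral>\<^sup>+y. (\<integral>\<^sup>+x. B (y - R x) * h y \<partial>lborel) \<partial>lborel)"
    by (rule lborel_pair.Fubini') simp
  also have "\<dots> = (\<integral>\<^sup>+y. (\<integral>\<^sup>+x. B (- R x) * h y \<partial>lborel) \<partial>lborel)"
  proof (rule nn_integral_cong)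
    fix y
    show "(\<integral>\<^sup>+x. B (y - R x) * h y \<partial>lborel) = (\<integral>\<^sup>+x. B (- R x) * h y \<partial>lborel)"
      using tr[of "\<lambda>x. B (y - R x) * h y" "inv R y"] by (simp add: RR)
  qed
  also have "\<dots> = (\<integral>\<^sup>+y. B y \<partial>lborel) * (\<integral>\<^sup>+y. h y \<partial>lborel)"
    by (simp add: BR nn_integral_cmult nn_integral_multc)
  finally have "(\<integral>\<^sup>+y. B y \<partial>lborel) * (\<integral>\<^sup>+x. h (R x) \<partial>lborel) = (\<integral>\<^sup>+y. B y \<partial>lborel) * (\<integral>\<^sup>+y. h y \<partial>lborel)" .
  moreover have "(\<integral>\<^sup>+y. B y \<partial>lborel) = emeasure lborel (ball (0::'a) 1)" by (simp add: B_def)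
  moreover have "emeasure lborel (ball (0::'a) 1) < \<infinity>" by (rule emeasure_lborel_ball_finite)
  moreover have "emeasure lborel (ball (0::'a) 1) \<noteq> 0"
    using content_ball_pos[of 1 "0::'a"] by (auto simp: measure_def)
  ultimately show ?thesis by (auto simp: ennreal_mult_cancel_left)
qed

abbreviation std_normal :: "real measure" where
  "std_normal \<equiv> density lborel (\<lambda>x. ennreal (std_normal_density x))"

lemma prob_space_std_normal: "prob_space std_normal"
  by (rule prob_space_normal_density) simp

lemma sigma_finite_std_normal: "sigma_finite_measure std_normal"
  using prob_space_std_normal by (rule prob_space_imp_sigma_finite)

text \<open>The law of \<open>Z0\<close>; \<open>gaussian_measure V\<close> is its image under
  \<open>msqrt V\<close>.\<close>

definition std_gaussian :: "(real^'d) measure" where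
  "std_gaussian = distr (\<Pi>\<^sub>M k\<in>(UNIV::'d set). std_normal) borel (\<lambda>z. \<chi> k. z k)"

lemma borel_measurable_vec_nth [measurable]: "(\<lambda>x. x $ k) \<in> borel_measurable borel"
  for k :: "'d::finite"
  by (intro borel_measurable_continuous_onI continuous_intros)

lemma borel_measurable_linear:
  fixes L :: "'a::euclidean_space \<Rightarrow> 'b::euclidean_space"
  assumes "linear L"
  shows "L \<in> borel_measurable borel"
  using assms by (intro borel_measurable_continuous_onI linear_continuous_on linear_linear[THEN iffD2])

lemma borel_measurable_vec_lambda:
  fixes f :: "'a \<Rightarrow> 'd::finite \<Rightarrow> 'b::euclidean_space"
  assumes "\<And>k. (\<lambda>x. f x k) \<in> borel_measurable M"
  shows "(\<lambda>x. \<chi> k. f x k) \<in> borel_measurable M"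
  using assms
  by (subst borel_measurable_euclidean_space) (auto simp: Basis_vec_def inner_axis)

lemma measurable_vec_lambda [measurable]:
  fixes N :: "'d::finite \<Rightarrow> real measure"
  assumes "\<And>k. sets (N k) = sets borel"
  shows "(\<lambda>z. \<chi> k. z k) \<in> borel_measurable (\<Pi>\<^sub>M k\<in>UNIV. N k)"
  using measurable_component_singleton[of _ UNIV N] assms
  by (intro borel_measurable_vec_lambda) (simp cong: measurable_cong_sets)

text \<open>Lebesgue measure is determined by its values on boxes, and the preimage of a box is a
  product of intervals. This links product measures on functions with the vector type.\<close>

lemma distr_PiM_lborel_vec:
  "distr (\<Pi>\<^sub>M k\<in>(UNIV::'d::finite set). lborel) borel (\<lambda>z. \<chi> k. z k) = (lborel :: (real^'d) measure)"
proof (rule lborel_eqI[symmetric])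
  fix l u :: "real^'d" assume lu: "\<And>b. b \<in> Basis \<Longrightarrow> l \<bullet> b \<le> u \<bullet> b"
  interpret product_sigma_finite "\<lambda>_::'d. lborel :: real measure"
    by (simp add: product_sigma_finite_def sigma_finite_lborel)
  have lu': "l $ k \<le> u $ k" for k
    using lu[of "axis k 1"] by (simp add: inner_axis axis_in_Basis_iff)
  have "(\<lambda>z. \<chi> k. z k) -` box l u \<inter> space (\<Pi>\<^sub>M k\<in>(UNIV::'d set). lborel)
      = (\<Pi>\<^sub>E k\<in>UNIV. {l $ k <..< u $ k})"
    by (auto simp: mem_box_cart space_PiM PiE_def Pi_def)
  then have "emeasure (distr (\<Pi>\<^sub>M k\<in>(UNIV::'d set). lborel) borel (\<lambda>z. \<chi> k. z k)) (box l u)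
      = (\<Prod>k\<in>UNIV. ennreal (u $ k - l $ k))"
    using lu' by (simp add: emeasure_distr emeasure_PiM)
  also have "\<dots> = ennreal (\<Prod>k\<in>UNIV. u $ k - l $ k)"
    using lu' by (simp add: prod_ennreal)
  also have "(\<Prod>k\<in>UNIV. u $ k - l $ k) = (\<Prod>b\<in>(Basis::(real^'d) set). (u - l) \<bullet> b)"
  proof -
    have "(\<Prod>b\<in>(Basis::(real^'d) set). (u - l) \<bullet> b)
        = (\<Prod>b\<in>range (\<lambda>k. axis k 1). (u - l) \<bullet> b)"
      by (rule prod.cong) (auto simp: Basis_vec_def)
    also have "\<dots> = (\<Prod>k\<in>UNIV. (u - l) \<bullet> axis k 1)"
      by (subst prod.reindex) (auto simp: inj_on_def axis_eq_axis)
    finally show ?thesis by (simp add: inner_axis)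
  qed
  finally show "emeasure (distr (\<Pi>\<^sub>M k\<in>(UNIV::'d set). lborel) borel (\<lambda>z. \<chi> k. z k)) (box l u)
      = (\<Prod>b\<in>Basis. (u - l) \<bullet> b)" .
qed simp

text \<open>It suffices to compare both sides on rectangles, where the indicator factorises over the
  coordinates and the integral of a product becomes a product of integrals.\<close>

lemma PiM_density:
  fixes f :: "'i \<Rightarrow> 'b \<Rightarrow> ennreal"
  assumes I: "finite I" and N: "\<And>i. sigma_finite_measure (N i)"
    and Nf: "\<And>i. sigma_finite_measure (density (N i) (f i))"
    and f [measurable]: "\<And>i. f i \<in> borel_measurable (N i)"
  shows "(\<Pi>\<^sub>M i\<in>I. density (N i) (f i)) = density (\<Pi>\<^sub>M i\<in>I. N i) (\<lambda>x. \<Prod>i\<in>I. f i (x i))"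
proof (rule product_sigma_finite.PiM_eqI[symmetric])
  interpret product_sigma_finite N using N by (simp add: product_sigma_finite_def)
  have [measurable]: "(\<lambda>x. \<Prod>i\<in>I. f i (x i)) \<in> borel_measurable (\<Pi>\<^sub>M i\<in>I. N i)"
    using f by (intro borel_measurable_prod_ennreal measurable_compose[OF measurable_component_singleton])
  show "product_sigma_finite (\<lambda>i. density (N i) (f i))"
    using Nf by (simp add: product_sigma_finite_def)
  fix A assume A: "\<And>i. i \<in> I \<Longrightarrow> A i \<in> sets (density (N i) (f i))"
  then have [measurable]: "Pi\<^sub>E I A \<in> sets (\<Pi>\<^sub>M i\<in>I. N i)"
    using I by (intro sets_PiM_I_finite) auto
  have "emeasure (density (\<Pi>\<^sub>M i\<in>I. N i) (\<lambda>x. \<Prod>i\<in>I. f i (x i))) (Pi\<^sub>E I A)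
      = (\<integral>\<^sup>+x. (\<Prod>i\<in>I. f i (x i)) * indicator (Pi\<^sub>E I A) x \<partial>PiM I N)"
    by (simp add: emeasure_density)
  also have "\<dots> = (\<integral>\<^sup>+x. (\<Prod>i\<in>I. f i (x i) * indicator (A i) (x i)) \<partial>PiM I N)"
  proof (intro nn_integral_cong)
    fix x assume "x \<in> space (PiM I N)"
    then have "indicator (Pi\<^sub>E I A) x = (\<Prod>i\<in>I. indicator (A i) (x i) :: ennreal)"
      using I by (auto simp: indicator_def space_PiM PiE_iff)
    then show "(\<Prod>i\<in>I. f i (x i)) * indicator (Pi\<^sub>E I A) x = (\<Prod>i\<in>I. f i (x i) * indicator (A i) (x i))"
      by (simp add: prod.distrib)
  qed
  also have "\<dots> = (\<Prod>i\<in>I. \<integral>\<^sup>+x. f i x * indicator (A i) x \<partial>N i)"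
    using A I by (intro product_nn_integral_prod) auto
  also have "\<dots> = (\<Prod>i\<in>I. emeasure (density (N i) (f i)) (A i))"
    using A by (intro prod.cong) (auto simp: emeasure_density)
  finally show "emeasure (density (\<Pi>\<^sub>M i\<in>I. N i) (\<lambda>x. \<Prod>i\<in>I. f i (x i))) (Pi\<^sub>E I A)
    = (\<Prod>i\<in>I. emeasure (density (N i) (f i)) (A i))" .
qed (use I in \<open>auto intro!: sets_PiM_cong\<close>)

text \<open>The product of the one-dimensional densities depends on the point through its norm
  alone, which makes rotation invariance accessible.\<close>

lemma std_gaussian_density:
  "(std_gaussian :: (real^'d) measure)
    = density lborel (\<lambda>x. ennreal ((1 / sqrt (2 * pi)) ^ CARD('d) * exp (- (norm x)\<^sup>2 / 2)))"
    (is "_ = density lborel ?f")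
proof -
  have *: "(\<Prod>k\<in>UNIV. ennreal (std_normal_density (z k))) = ?f (\<chi> k. z k)" for z :: "'d \<Rightarrow> real"
    by (simp add: prod_ennreal std_normal_density_def prod.distrib prod_dividef exp_sum[symmetric]
        norm_vec_def L2_set_def sum_nonneg sum_negf sum_divide_distrib power_divide)
  have "(std_gaussian :: (real^'d) measure)
      = distr (density (\<Pi>\<^sub>M k\<in>(UNIV::'d set). lborel) (\<lambda>z. ?f (\<chi> k. z k))) borel (\<lambda>z. \<chi> k. z k)"
    unfolding std_gaussian_def
    by (subst PiM_density) (auto simp: * sigma_finite_lborel sigma_finite_std_normal)
  also have "\<dots> = density (distr (\<Pi>\<^sub>M k\<in>(UNIV::'d set). lborel) borel (\<lambda>z. \<chi> k. z k)) ?f"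
    by (subst density_distr) auto
  finally show ?thesis by (simp add: distr_PiM_lborel_vec)
qed

section \<open>Invariance of the standard Gaussian law under rotation and resampling\<close>

lemma sets_std_gaussian [simp, measurable_cong]: "sets std_gaussian = sets borel"
  by (simp add: std_gaussian_def)

lemma space_std_gaussian [simp]: "space std_gaussian = UNIV"
  by (simp add: std_gaussian_def)

lemma prob_space_std_gaussian: "prob_space (std_gaussian :: (real^'d) measure)"
  unfolding std_gaussian_def
  by (intro prob_space.prob_space_distr prob_space_PiM prob_space_std_normal measurable_vec_lambda) simp

text \<open>The density is radial and Lebesgue measure is invariant under orthogonal maps.\<close>

lemma std_gaussian_orthogonal:
  fixes R :: "real^'d \<Rightarrow> real^'d"
  assumes R: "orthogonal_transformation R"
  shows "distr std_gaussian borel R = std_gaussian"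
proof (rule measure_eqI)
  have [measurable]: "R \<in> borel_measurable borel"
    using R by (intro borel_measurable_continuous_onI linear_continuous_on linear_linear[THEN iffD2]
        orthogonal_transformation_linear)
  fix A assume "A \<in> sets (distr std_gaussian borel R)"
  then have [measurable]: "A \<in> sets borel" by simp
  have [measurable]: "R -` A \<in> sets borel"
    using measurable_sets[of R borel borel A] by simp
  let ?f = "\<lambda>x::real^'d. ennreal ((1 / sqrt (2 * pi)) ^ CARD('d) * exp (- (norm x)\<^sup>2 / 2))"
  have "emeasure (distr std_gaussian borel R) A = emeasure std_gaussian (R -` A)"
    by (simp add: emeasure_distr space_std_gaussian)
  also have "\<dots> = (\<integral>\<^sup>+x. ?f (R x) * indicator A (R x) \<partial>lborel)"
    using R by (simp add: std_gaussian_density emeasure_density orthogonal_transformation indicator_def)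
  also have "\<dots> = (\<integral>\<^sup>+x. ?f x * indicator A x \<partial>lborel)"
    by (rule nn_integral_lborel_orthogonal[OF R]) measurable
  also have "\<dots> = emeasure std_gaussian A"
    by (simp add: std_gaussian_density emeasure_density)
  finally show "emeasure (distr std_gaussian borel R) A = emeasure std_gaussian A" .
qed simp

text \<open>Coordinates of a product measure are independent, so exchanging one of them for a fresh
  copy preserves the law. This is checked on rectangles for functions and then carried over to
  vectors.\<close>

lemma std_gaussian_resample_coordinate:
  "distr (std_gaussian \<Otimes>\<^sub>M std_normal) borel (\<lambda>(w, t). (\<chi> j. if j = k then t else w $ j))
    = (std_gaussian :: (real^'d) measure)"
proof -
  let ?P = "\<Pi>\<^sub>M k\<in>(UNIV::'d set). std_normal"
  interpret N: prob_space std_normal by (rule prob_space_std_normal)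
  interpret product_sigma_finite "\<lambda>_::'d. std_normal"
    by (simp add: product_sigma_finite_def sigma_finite_std_normal)
  interpret P: prob_space ?P by (intro prob_space_PiM prob_space_std_normal)
  interpret PN: pair_sigma_finite ?P std_normal ..
  have upd: "(\<lambda>(z, t). z(k := t)) \<in> measurable (?P \<Otimes>\<^sub>M std_normal) ?P"
    by (simp add: split_beta') (rule measurable_fun_upd[where J=UNIV], auto)
  have "distr (?P \<Otimes>\<^sub>M std_normal) ?P (\<lambda>(z, t). z(k := t)) = ?P"
  proof (rule PiM_eqI)
    fix A :: "'d \<Rightarrow> real set" assume A: "\<And>i. i \<in> UNIV \<Longrightarrow> A i \<in> sets std_normal"
    \<comment> \<open>The overwritten coordinate \<open>k\<close> of the old point is unconstrained
      and contributes mass 1; the condition \<open>A k\<close> falls on the fresh value.\<close>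
    have "(\<lambda>(z, t). z(k := t)) -` (Pi\<^sub>E UNIV A) \<inter> space (?P \<Otimes>\<^sub>M std_normal)
       = (Pi\<^sub>E UNIV (A(k := UNIV))) \<times> A k"
      by (auto simp: space_pair_measure space_PiM PiE_def Pi_def split: if_splits)
    then have "emeasure (distr (?P \<Otimes>\<^sub>M std_normal) ?P (\<lambda>(z, t). z(k := t))) (Pi\<^sub>E UNIV A)
       = emeasure ?P (Pi\<^sub>E UNIV (A(k := UNIV))) * emeasure std_normal (A k)"
      using A upd by (subst emeasure_distr)
        (auto intro!: N.emeasure_pair_measure_Times sets_PiM_I_finite)
    also have "\<dots> = (\<Prod>j\<in>UNIV. emeasure std_normal ((A(k := UNIV)) j)) * emeasure std_normal (A k)"
      using A by (subst emeasure_PiM) auto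
    also have "\<dots> = (\<Prod>j\<in>UNIV. emeasure std_normal (A j))"
      using N.emeasure_space_1 by (simp add: prod.remove[of UNIV k] mult.commute)
    finally show "emeasure (distr (?P \<Otimes>\<^sub>M std_normal) ?P (\<lambda>(z, t). z(k := t))) (Pi\<^sub>E UNIV A)
       = (\<Prod>j\<in>UNIV. emeasure std_normal (A j))" .
  qed auto
  note upd_distr = this
  have vec: "(\<lambda>z. \<chi> j. z j) \<in> borel_measurable ?P" by (rule measurable_vec_lambda) simp
  have "std_gaussian \<Otimes>\<^sub>M std_normal
      = distr ?P borel (\<lambda>z. \<chi> j. z j) \<Otimes>\<^sub>M distr std_normal std_normal (\<lambda>t. t)"
    by (simp add: std_gaussian_def distr_id2)
  also have "\<dots> = distr (?P \<Otimes>\<^sub>M std_normal) (borel \<Otimes>\<^sub>M std_normal) (\<lambda>(z, t). (\<chi> j. z j, t))"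
    by (rule pair_measure_distr) (auto simp: distr_id2 sigma_finite_std_normal vec)
  finally have "distr (std_gaussian \<Otimes>\<^sub>M std_normal) borel (\<lambda>(w, t). (\<chi> j. if j = k then t else w $ j))
    = distr (?P \<Otimes>\<^sub>M std_normal) borel ((\<lambda>(w, t). (\<chi> j. if j = k then t else w $ j)) \<circ> (\<lambda>(z, t). (\<chi> j. z j, t)))"
  proof (simp only:, intro distr_distr)
    have "(\<lambda>p. if j = k then snd p else fst p $ j) \<in> borel_measurable (borel \<Otimes>\<^sub>M std_normal)"
      for j
      by (cases "j = k") auto
    then show "(\<lambda>(w, t). (\<chi> j. if j = k then t else w $ j))
        \<in> borel_measurable (borel \<Otimes>\<^sub>M std_normal)"
      unfolding split_beta' by (rule borel_measurable_vec_lambda)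
    show "(\<lambda>(z, t). (\<chi> j. z j, t)) \<in> ?P \<Otimes>\<^sub>M std_normal \<rightarrow>\<^sub>M borel \<Otimes>\<^sub>M std_normal"
      unfolding split_beta' using vec
      by (intro measurable_Pair measurable_compose[OF measurable_fst] measurable_snd) auto
  qed
  also have "(\<lambda>(w, t). (\<chi> j. if j = k then t else w $ j)) \<circ> (\<lambda>(z, t). (\<chi> j. z j, t))
    = (\<lambda>z. \<chi> j. z j) \<circ> (\<lambda>(z, t). z(k := t))"
    by (auto simp: fun_eq_iff vec_eq_iff)
  also have "distr (?P \<Otimes>\<^sub>M std_normal) borel ((\<lambda>z. \<chi> j. z j) \<circ> (\<lambda>(z, t). z(k := t)))
    = distr (distr (?P \<Otimes>\<^sub>M std_normal) ?P (\<lambda>(z, t). z(k := t))) borel (\<lambda>z. \<chi> j. z j)"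
    using vec upd by (rule distr_distr[symmetric])
  also have "\<dots> = std_gaussian" by (simp add: upd_distr std_gaussian_def)
  finally show ?thesis .
qed


text \<open>Rotate the unit vector onto a coordinate axis: there the update replaces one coordinate by
  an independent copy.\<close>

lemma std_gaussian_resample_direction:
  fixes f :: "real^'d"
  assumes "norm f = 1"
  shows "distr (std_gaussian \<Otimes>\<^sub>M std_normal) borel (\<lambda>(z, t). z - (f \<bullet> z) *\<^sub>R f + t *\<^sub>R f) = std_gaussian"
proof -
  let ?\<gamma> = "std_gaussian :: (real^'d) measure"
  \<comment> \<open>\<open>undefined\<close> names some fixed coordinate; any unit vector can be
    rotated onto any axis.\<close>
  let ?e = "axis undefined 1 :: real^'d"
  obtain R :: "real^'d \<Rightarrow> real^'d" where R: "orthogonal_transformation R" "R ?e = f"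
    using orthogonal_transformation_exists_1[of ?e f] assms by auto
  have lin: "linear R" using R by (simp add: orthogonal_transformation_linear)
  have [measurable]: "R \<in> borel_measurable borel" using lin by (rule borel_measurable_linear)
  define u where "u = (\<lambda>(w :: real^'d, t). (\<chi> j. if j = undefined then t else w $ j) :: real^'d)"
  have u: "u (w, t) = w - (?e \<bullet> w) *\<^sub>R ?e + t *\<^sub>R ?e" for w t
  proof -
    have "?e \<bullet> w = w $ undefined" by (simp add: inner_axis')
    then show ?thesis by (simp only:) (simp add: u_def vec_eq_iff axis_def)
  qed
  have [measurable]: "u \<in> borel_measurable (borel \<Otimes>\<^sub>M borel)"
  proof -
    have "u = (\<lambda>p. fst p - (?e \<bullet> fst p) *\<^sub>R ?e + snd p *\<^sub>R ?e)"
      by (auto simp: u fun_eq_iff)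
    then show ?thesis by simp
  qed
  have "?\<gamma> \<Otimes>\<^sub>M std_normal = distr ?\<gamma> borel R \<Otimes>\<^sub>M distr std_normal std_normal (\<lambda>t. t)"
    by (simp add: std_gaussian_orthogonal[OF R(1)] distr_id2)
  also have "\<dots> = distr (?\<gamma> \<Otimes>\<^sub>M std_normal) (borel \<Otimes>\<^sub>M std_normal) (\<lambda>(w, t). (R w, t))"
    by (rule pair_measure_distr) (auto simp: distr_id2 sigma_finite_std_normal)
  finally have "distr (?\<gamma> \<Otimes>\<^sub>M std_normal) borel (\<lambda>(z, t). z - (f \<bullet> z) *\<^sub>R f + t *\<^sub>R f)
     = distr (distr (?\<gamma> \<Otimes>\<^sub>M std_normal) (borel \<Otimes>\<^sub>M std_normal) (\<lambda>(w, t). (R w, t))) borel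
         (\<lambda>(z, t). z - (f \<bullet> z) *\<^sub>R f + t *\<^sub>R f)"
    by simp
  also have "\<dots> = distr (?\<gamma> \<Otimes>\<^sub>M std_normal) borel
      ((\<lambda>(z, t). z - (f \<bullet> z) *\<^sub>R f + t *\<^sub>R f) \<circ> (\<lambda>(w, t). (R w, t)))"
    by (rule distr_distr) measurable
  \<comment> \<open>As \<open>R\<close> preserves inner products and maps \<open>?e\<close> to
    \<open>f\<close>, updating along \<open>f\<close> after the rotation equals rotating after the
    update along \<open>?e\<close>.\<close>
  also have "(\<lambda>(z, t). z - (f \<bullet> z) *\<^sub>R f + t *\<^sub>R f) \<circ> (\<lambda>(w, t). (R w, t)) = R \<circ> u"
    using R lin by (auto simp: fun_eq_iff u linear_add linear_diff linear_scale orthogonal_transformation_def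
        simp flip: R(2))
  also have "distr (?\<gamma> \<Otimes>\<^sub>M std_normal) borel (R \<circ> u) = distr (distr (?\<gamma> \<Otimes>\<^sub>M std_normal) borel u) borel R"
    by (rule distr_distr[symmetric]) measurable
  also have "\<dots> = std_gaussian"
    by (simp add: u_def std_gaussian_resample_coordinate std_gaussian_orthogonal[OF R(1)])
  finally show ?thesis .
qed

subsection \<open>Independence and vector-valued integrals\<close>

text \<open>Expansion in the basis reduces the claim to the product rule for independent real
  variables; hence independence is required one coordinate at a time.\<close>

lemma indep_scaleR:
  fixes \<phi> :: "'a \<Rightarrow> real" and A :: "'a \<Rightarrow> 'b::euclidean_space"
  assumes M: "prob_space M" and ind: "\<And>b. prob_space.indep_var M borel \<phi> borel (\<lambda>\<omega>. A \<omega> \<bullet> b)"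
    and \<phi>: "integrable M \<phi>" and A: "integrable M A"
  shows "integrable M (\<lambda>\<omega>. \<phi> \<omega> *\<^sub>R A \<omega>)"
    and "(\<integral>\<omega>. \<phi> \<omega> *\<^sub>R A \<omega> \<partial>M) = (\<integral>\<omega>. \<phi> \<omega> \<partial>M) *\<^sub>R (\<integral>\<omega>. A \<omega> \<partial>M)"
proof -
  interpret prob_space M by (rule M)
  have int: "integrable M (\<lambda>\<omega>. \<phi> \<omega> * (A \<omega> \<bullet> b))" for b
    using \<phi> A by (intro indep_var_integrable[OF ind]) auto
  have "integrable M (\<lambda>\<omega>. \<Sum>b\<in>Basis. (\<phi> \<omega> * (A \<omega> \<bullet> b)) *\<^sub>R b)"
    using int by (intro Bochner_Integration.integrable_sum integrable_scaleR_left)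
  also have "(\<lambda>\<omega>. \<Sum>b\<in>Basis. (\<phi> \<omega> * (A \<omega> \<bullet> b)) *\<^sub>R b) = (\<lambda>\<omega>. \<phi> \<omega> *\<^sub>R A \<omega>)"
    by (simp only: scaleR_scaleR[symmetric] scaleR_sum_right[symmetric] euclidean_representation)
  finally show int': "integrable M (\<lambda>\<omega>. \<phi> \<omega> *\<^sub>R A \<omega>)" .
  show "(\<integral>\<omega>. \<phi> \<omega> *\<^sub>R A \<omega> \<partial>M) = (\<integral>\<omega>. \<phi> \<omega> \<partial>M) *\<^sub>R (\<integral>\<omega>. A \<omega> \<partial>M)"
  proof (rule euclidean_eqI)
    fix b :: 'b
    have "(\<integral>\<omega>. \<phi> \<omega> *\<^sub>R A \<omega> \<partial>M) \<bullet> b = (\<integral>\<omega>. \<phi> \<omega> * (A \<omega> \<bullet> b) \<partial>M)"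
      using int' by (subst integral_inner_left[symmetric]) auto
    also have "\<dots> = (\<integral>\<omega>. \<phi> \<omega> \<partial>M) * (\<integral>\<omega>. A \<omega> \<bullet> b \<partial>M)"
      using \<phi> A by (intro indep_var_lebesgue_integral[OF ind]) auto
    also have "\<dots> = ((\<integral>\<omega>. \<phi> \<omega> \<partial>M) *\<^sub>R (\<integral>\<omega>. A \<omega> \<partial>M)) \<bullet> b"
      using A by simp
    finally show "(\<integral>\<omega>. \<phi> \<omega> *\<^sub>R A \<omega> \<partial>M) \<bullet> b = ((\<integral>\<omega>. \<phi> \<omega> \<partial>M) *\<^sub>R (\<integral>\<omega>. A \<omega> \<partial>M)) \<bullet> b" .
  qed
qed

lemma integrable_vec_iff:
  fixes A :: "'a \<Rightarrow> 'b::euclidean_space ^ 'n"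
  shows "integrable M A \<longleftrightarrow> (\<forall>a. integrable M (\<lambda>\<omega>. A \<omega> $ a))"
proof
  assume "\<forall>a. integrable M (\<lambda>\<omega>. A \<omega> $ a)"
  then have "integrable M (\<lambda>\<omega>. \<Sum>a\<in>UNIV. axis a (A \<omega> $ a))"
    by (intro Bochner_Integration.integrable_sum integrable_bounded_linear[of "axis _"])
       (auto simp: linear_conv_bounded_linear[symmetric] linear_iff axis_def vec_eq_iff)
  also have "(\<lambda>\<omega>. \<Sum>a\<in>UNIV. axis a (A \<omega> $ a)) = A"
    by (intro ext) (simp add: vec_eq_iff axis_def)
  finally show "integrable M A" .
next
  assume "integrable M A"
  then show "\<forall>a. integrable M (\<lambda>\<omega>. A \<omega> $ a)"
    by (intro allI integrable_bounded_linear[OF bounded_linear_vec_nth])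
qed

lemma integral_vec_nth:
  fixes A :: "'a \<Rightarrow> 'b::euclidean_space ^ 'n"
  assumes "integrable M A"
  shows "(\<integral>\<omega>. A \<omega> \<partial>M) $ a = (\<integral>\<omega>. A \<omega> $ a \<partial>M)"
  using integral_bounded_linear[OF bounded_linear_vec_nth assms] by (rule sym)

lemma integral_linear:
  fixes A :: "'a \<Rightarrow> 'b::euclidean_space" and L :: "'b \<Rightarrow> 'c::euclidean_space"
  assumes "linear L" "integrable M A"
  shows "integrable M (\<lambda>\<omega>. L (A \<omega>))" and "(\<integral>\<omega>. L (A \<omega>) \<partial>M) = L (\<integral>\<omega>. A \<omega> \<partial>M)"
proof -
  have L: "bounded_linear L" using assms by (simp add: linear_conv_bounded_linear)
  show "integrable M (\<lambda>\<omega>. L (A \<omega>))" using assms by (intro integrable_bounded_linear[OF L])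
  show "(\<integral>\<omega>. L (A \<omega>) \<partial>M) = L (\<integral>\<omega>. A \<omega> \<partial>M)" using assms by (intro integral_bounded_linear[OF L])
qed

text \<open>Grouping independent families over disjoint index sets preserves independence. This is
  what separates the past of the chain from the fresh index and noise.\<close>

lemma (in prob_space) indep_set_blocks:
  assumes F: "indep_sets F UNIV" "\<And>j. Int_stable (F j)" and disj: "J \<inter> K = {}"
  shows "indep_set (sigma_sets (space M) (\<Union>j\<in>J. F j)) (sigma_sets (space M) (\<Union>j\<in>K. F j))"
proof -
  have "indep_sets (\<lambda>b. sigma_sets (space M) (\<Union>j\<in>case_bool J K b. F j)) UNIV"
    using disj F
    by (intro indep_sets_collect_sigma)
       (auto simp: disjoint_family_on_def split: bool.split intro: indep_sets_mono_index)
  then show ?thesis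
    unfolding indep_set_def by (rule indep_sets_mono_sets) (auto split: bool.split)
qed

text \<open>Independence of the two sub-sigma-algebras factorises the joint law on rectangles, which
  determine a product measure.\<close>

lemma (in prob_space) indep_set_distr_pair:
  assumes ind: "indep_set (sets A) (sets B)"
    and X: "X \<in> measurable A S" and Y: "Y \<in> measurable B T"
    and A: "space A = space M" "sets A \<subseteq> events" and B: "space B = space M" "sets B \<subseteq> events"
  shows "distr M (S \<Otimes>\<^sub>M T) (\<lambda>\<omega>. (X \<omega>, Y \<omega>)) = distr M S X \<Otimes>\<^sub>M distr M T Y"
proof (rule pair_measure_eqI[symmetric])
  have [measurable]: "X \<in> measurable M S" "Y \<in> measurable M T"
    using X Y A B by (auto simp: measurable_def)
  show "sigma_finite_measure (distr M S X)" "sigma_finite_measure (distr M T Y)"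
    by (intro prob_space_imp_sigma_finite prob_space_distr; measurable)+
  show "sets (distr M S X \<Otimes>\<^sub>M distr M T Y) = sets (distr M (S \<Otimes>\<^sub>M T) (\<lambda>\<omega>. (X \<omega>, Y \<omega>)))"
    by (simp cong: sets_pair_measure_cong)
  fix C D assume "C \<in> sets (distr M S X)" "D \<in> sets (distr M T Y)"
  then have [measurable]: "C \<in> sets S" "D \<in> sets T" by auto
  have "(\<lambda>\<omega>. (X \<omega>, Y \<omega>)) -` (C \<times> D) \<inter> space M = (X -` C \<inter> space M) \<inter> (Y -` D \<inter> space M)"
    by auto
  moreover have "prob ((X -` C \<inter> space M) \<inter> (Y -` D \<inter> space M)) = prob (X -` C \<inter> space M) * prob (Y -` D \<inter> space M)"
    using measurable_sets[OF X, of C] measurable_sets[OF Y, of D] A B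
    by (intro indep_setD[OF ind]) auto
  ultimately show "emeasure (distr M S X) C * emeasure (distr M T Y) D
      = emeasure (distr M (S \<Otimes>\<^sub>M T) (\<lambda>\<omega>. (X \<omega>, Y \<omega>))) (C \<times> D)"
    by (simp add: emeasure_distr emeasure_eq_measure ennreal_mult'[symmetric])
qed

lemma (in prob_space) indep_set_indep_var:
  assumes ind: "indep_set (sets A) (sets B)"
    and X: "X \<in> measurable A S" and Y: "Y \<in> measurable B T"
    and A: "space A = space M" "sets A \<subseteq> events" and B: "space B = space M" "sets B \<subseteq> events"
  shows "indep_var S X T Y"
proof -
  have "X \<in> measurable M S" "Y \<in> measurable M T"
    using X Y A B by (auto simp: measurable_def)
  then show ?thesis
    unfolding indep_var_distribution_eq using indep_set_distr_pair[OF assms] by simp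
qed

subsection \<open>The averaged compression operator\<close>

lemma psd_matrix_0: "psd_matrix 0"
  by (simp add: psd_matrix_def vec_eq_iff transpose_def)

lemma psd_matrix_add: "psd_matrix A \<Longrightarrow> psd_matrix B \<Longrightarrow> psd_matrix (A + B)"
  by (simp add: psd_matrix_def transpose_add matrix_vector_mult_add_rdistrib inner_add_right)

lemma psd_matrix_scaleR: "psd_matrix A \<Longrightarrow> 0 \<le> c \<Longrightarrow> psd_matrix (c *\<^sub>R A)"
  by (simp add: psd_matrix_def transpose_scaleR scaleR_matrix_vector_assoc[symmetric])

lemma psd_matrix_sum: "(\<And>k. k \<in> K \<Longrightarrow> psd_matrix (A k)) \<Longrightarrow> psd_matrix (\<Sum>k\<in>K. A k)"
  by (induction K rule: infinite_finite_induct) (auto intro: psd_matrix_0 psd_matrix_add)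

lemma psd_matrix_mat_1: "psd_matrix (mat 1)"
  by (simp add: psd_matrix_def)

lemma psd_matrix_congruence:
  assumes A: "psd_matrix A" and Q: "transpose Q = Q"
  shows "psd_matrix (Q ** A ** Q)"
proof -
  have "x \<bullet> ((Q ** A ** Q) *v x) = (Q *v x) \<bullet> (A *v (Q *v x))" for x
    by (simp add: matrix_vector_mul_assoc[symmetric] inner_symmetric_matrix[OF Q])
  then show ?thesis
    using A Q by (simp add: psd_matrix_def matrix_transpose_mul matrix_mul_assoc)
qed

lemma trace_psd_nonneg: "psd_matrix A \<Longrightarrow> 0 \<le> trace A"
  unfolding trace_def
proof (intro sum_nonneg)
  fix k assume "psd_matrix A"
  then have "0 \<le> axis k 1 \<bullet> (A *v axis k 1)" by (simp add: psd_matrix_def)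
  then show "0 \<le> A $ k $ k"
    by (simp add: matrix_vector_mult_basis inner_axis' column_def)
qed

lemma trace_scaleR: "trace (c *\<^sub>R A) = c * trace (A :: real^'n^'n)"
  by (simp add: trace_def sum_distrib_left)

lemma trace_sum: "trace (\<Sum>k\<in>K. A k) = (\<Sum>k\<in>K. trace (A k))" for A :: "'k \<Rightarrow> real^'n^'n"
  by (induction K rule: infinite_finite_induct) (simp_all add: trace_add trace_0[unfolded mat_0])

lemma matrix_mult_scaleR:
  fixes A B :: "real^'n^'n"
  shows "(c *\<^sub>R A) ** B = c *\<^sub>R (A ** B)" and "A ** (c *\<^sub>R B) = c *\<^sub>R (A ** B)"
  by (simp_all add: vec_eq_iff matrix_matrix_mult_def sum_distrib_left mult_ac)

lemma matrix_add_rdistrib: "(A + B) ** C = A ** C + B ** (C :: real^'n^'m)"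
  by (simp add: vec_eq_iff matrix_matrix_mult_def sum.distrib algebra_simps)

lemma linear_matrix_mult2: "linear (\<lambda>A. Q ** A ** R)" for Q R :: "real^'n^'n"
  by (simp add: linear_iff matrix_add_ldistrib matrix_add_rdistrib matrix_mult_scaleR)

lemma outer_linear_left: "linear (\<lambda>x. outer x y)"
  by (simp add: linear_iff outer_def vec_eq_iff algebra_simps)

lemma outer_linear_right: "linear (outer x)"
  by (simp add: linear_iff outer_def vec_eq_iff algebra_simps)

lemma outer_matrix_mult: "outer (Q *v x) (R *v y) = Q ** outer x y ** transpose R"
proof -
  have "(R *v y) \<bullet> z = y \<bullet> (transpose R *v z)" for z
    by (metis dot_lmul_matrix inner_commute transpose_transpose vector_transpose_matrix)
  then show ?thesis
    by (simp add: matrix_eq matrix_vector_mul_assoc[symmetric] outer_mult_vec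
      matrix_vector_mult_scaleR)
qed

lemma trace_outer: "trace (outer x y) = x \<bullet> y"
  by (simp add: trace_def outer_def inner_vec_def)

text \<open>The operator \<open>T\<close> of the overview: the expected compression by
  \<open>Pmat V k\<close> when \<open>k\<close> is uniformly distributed.\<close>

definition mean_compression :: "real^'d^'d \<Rightarrow> real^'d^'d \<Rightarrow> real^'d^'d" where
  "mean_compression V A = (1 / real CARD('d)) *\<^sub>R (\<Sum>k\<in>UNIV. Pmat V k ** A ** Pmat V k)"

lemma linear_mean_compression: "linear (mean_compression V)"
  unfolding mean_compression_def
  by (intro linear_compose_scale_right linear_compose_sum ballI linear_matrix_mult2)

lemma linear_funpow: "linear f \<Longrightarrow> linear (f ^^ n)" for f :: "'b::real_vector \<Rightarrow> 'b"
  by (induction n) (simp_all add: linear_id[unfolded id_def] linear_compose linear_id)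

lemma Pmat_mult_vec: "Pmat V k *v x = x - (fvec V k \<bullet> x) *\<^sub>R fvec V k"
  by (simp add: Pmat_def matrix_vector_mult_diff_rdistrib outer_mult_vec)

lemma transpose_Pmat: "transpose (Pmat V k) = Pmat V k"
  by (simp add: Pmat_def transpose_diff transpose_outer)

lemma psd_mean_compression: "psd_matrix A \<Longrightarrow> psd_matrix (mean_compression V A)"
  unfolding mean_compression_def
  by (intro psd_matrix_scaleR psd_matrix_sum psd_matrix_congruence transpose_Pmat) auto

lemma psd_mean_compression_funpow: "psd_matrix A \<Longrightarrow> psd_matrix ((mean_compression V ^^ n) A)"
  by (induction n) (simp_all add: psd_mean_compression)

text \<open>In every summand, cyclicity of the trace moves the leading factor
  \<open>Pmat V k\<close> behind \<open>B\<close>.\<close>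

lemma trace_mean_compression_adjoint:
  "trace (mean_compression V A ** B) = trace (A ** mean_compression V B)"
proof -
  have "trace (Pmat V k ** A ** Pmat V k ** B) = trace (A ** (Pmat V k ** B ** Pmat V k))" for k
    using trace_mul_sym[of "Pmat V k" "A ** Pmat V k ** B"] by (simp add: matrix_mul_assoc)
  moreover have "mean_compression V A ** B
      = (1 / real CARD('a)) *\<^sub>R (\<Sum>k\<in>UNIV. Pmat V k ** A ** Pmat V k ** B)"
    unfolding mean_compression_def
    using linear_sum[OF linear_matrix_mult2[of "mat 1" B], of "\<lambda>k. Pmat V k ** A ** Pmat V k" UNIV]
    by (simp add: matrix_mult_scaleR)
  moreover have "A ** mean_compression V B
      = (1 / real CARD('a)) *\<^sub>R (\<Sum>k\<in>UNIV. A ** (Pmat V k ** B ** Pmat V k))"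
    unfolding mean_compression_def
    using linear_sum[OF linear_matrix_mult2[of A "mat 1"], of "\<lambda>k. Pmat V k ** B ** Pmat V k" UNIV]
    by (simp add: matrix_mult_scaleR)
  ultimately show ?thesis by (simp add: trace_scaleR trace_sum)
qed

lemma trace_mean_compression_funpow_adjoint:
  "trace ((mean_compression V ^^ n) A ** B) = trace (A ** (mean_compression V ^^ n) B)"
proof (induction n arbitrary: B)
  case (Suc n)
  have "trace ((mean_compression V ^^ Suc n) A ** B) = trace (A ** (mean_compression V ^^ n) (mean_compression V B))"
    by (simp add: trace_mean_compression_adjoint Suc)
  then show ?case by (simp add: funpow_swap1)
qed simp

text \<open>The common value of \<open>E \<parallel>M\<^sub>n\<parallel>\<^sup>2\<close>, of \<open>E \<parallel>\<surd>V (Y'\<^sub>n - Y\<^sub>n)\<parallel>\<^sup>2\<close> (where \<open>Y'\<close> is the chain started at \<open>Z\<^sub>0\<close>) and of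
  \<open>tr (V - cov X\<^sub>n)\<close>.\<close>

definition residual_trace :: "real^'d^'d \<Rightarrow> nat \<Rightarrow> real" where
  "residual_trace V n = trace (V ** (mean_compression V ^^ n) (mat 1))"

lemma transpose_msqrt: "psd_matrix V \<Longrightarrow> transpose (msqrt V) = msqrt V"
  using psd_msqrt[of V] by (simp add: psd_matrix_def)

section \<open>Decay of the residual trace for a matrix with unit diagonal\<close>

context
  fixes V :: "real^'d^'d"
  assumes V_psd: "psd_matrix V" and V_diag: "\<And>k. V $ k $ k = 1"
begin

text \<open>The squared length is the diagonal entry \<open>V $ k $ k\<close>. Thus
  \<open>Pmat V k\<close> is an orthogonal projection.\<close>

lemma norm_fvec: "norm (fvec V k) = 1"
proof -
  have "fvec V k \<bullet> fvec V k = axis k 1 \<bullet> ((msqrt V ** msqrt V) *v axis k 1)"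
    by (simp add: fvec_def matrix_vector_mul_assoc[symmetric] inner_symmetric_matrix[OF transpose_msqrt[OF V_psd], of "axis k 1"])
  also have "\<dots> = 1"
    by (simp add: msqrt_square[OF V_psd] matrix_vector_mult_basis inner_axis' column_def V_diag)
  finally show ?thesis by (simp add: norm_eq_sqrt_inner)
qed

text \<open>The vectors \<open>fvec V k\<close> are the columns of \<open>msqrt V\<close>, and the
  outer products of the columns of a matrix add up to the matrix times its transpose.\<close>

lemma sum_outer_fvec: "(\<Sum>k\<in>UNIV. outer (fvec V k) (fvec V k)) = V"
proof -
  have "(\<Sum>k\<in>UNIV. outer (fvec V k) (fvec V k)) = msqrt V ** transpose (msqrt V)"
    by (simp add: vec_eq_iff fvec_def matrix_vector_mult_basis column_def outer_def
        matrix_matrix_mult_def transpose_def)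
  then show ?thesis by (simp add: transpose_msqrt[OF V_psd] msqrt_square[OF V_psd])
qed

lemma Pmat_idem: "Pmat V k ** Pmat V k = Pmat V k"
  by (simp add: matrix_eq matrix_vector_mul_assoc[symmetric] Pmat_mult_vec inner_diff_right
      dot_square_norm norm_fvec)

lemma mean_compression_mat_1: "mean_compression V (mat 1) = mat 1 - (1 / real CARD('d)) *\<^sub>R V"
proof -
  have "(\<Sum>k\<in>UNIV. Pmat V k ** mat 1 ** Pmat V k) = (\<Sum>k\<in>UNIV. mat 1 - outer (fvec V k) (fvec V k))"
    by (simp add: Pmat_idem) (simp add: Pmat_def)
  also have "\<dots> = real CARD('d) *\<^sub>R mat 1 - V"
    by (simp add: sum_subtractf sum_outer_fvec scaleR_conv_of_real sum_constant_scaleR)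
  finally show ?thesis by (simp add: mean_compression_def scaleR_diff_right)
qed

text \<open>By linearity the decrement is the \<open>n\<close>-th iterate applied to
  \<open>mat 1 - mean_compression V (mat 1)\<close>, a multiple of \<open>V\<close>. It serves both
  monotonicity (the iterate of \<open>V\<close> is positive semi-definite) and the telescoping
  sum.\<close>

lemma mean_compression_decrement:
  "(mean_compression V ^^ n) (mat 1) - (mean_compression V ^^ Suc n) (mat 1)
    = (1 / real CARD('d)) *\<^sub>R (mean_compression V ^^ n) V"
proof -
  have "(mean_compression V ^^ n) (mat 1) - (mean_compression V ^^ Suc n) (mat 1)
    = (mean_compression V ^^ n) (mat 1 - mean_compression V (mat 1))"
    by (simp add: linear_diff[OF linear_funpow[OF linear_mean_compression]] funpow_swap1)
  also have "mat 1 - mean_compression V (mat 1) = (1 / real CARD('d)) *\<^sub>R V"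
    by (simp add: mean_compression_mat_1)
  finally show ?thesis by (simp add: linear_scale[OF linear_funpow[OF linear_mean_compression]])
qed

text \<open>The product of \<open>V\<close> with a positive semi-definite matrix is in general not
  symmetric; the congruence by \<open>msqrt V\<close> is positive semi-definite, and it is also the
  form in which the moments of \<open>X\<close> appear.\<close>

lemma residual_trace_msqrt:
  "residual_trace V n = trace (msqrt V ** (mean_compression V ^^ n) (mat 1) ** msqrt V)"
  using trace_mul_sym[of "msqrt V" "(mean_compression V ^^ n) (mat 1) ** msqrt V"]
    trace_mul_sym[of V "(mean_compression V ^^ n) (mat 1)"]
  by (simp add: residual_trace_def matrix_mul_assoc[symmetric] msqrt_square[OF V_psd])

lemma residual_trace_antimono_Suc: "residual_trace V (Suc n) \<le> residual_trace V n"
proof -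
  let ?Q = "(mean_compression V ^^ n) (mat 1) - (mean_compression V ^^ Suc n) (mat 1)"
  have "psd_matrix ?Q"
    unfolding mean_compression_decrement
    by (intro psd_matrix_scaleR psd_mean_compression_funpow V_psd) auto
  then have "0 \<le> trace (msqrt V ** ?Q ** msqrt V)"
    by (intro trace_psd_nonneg psd_matrix_congruence transpose_msqrt[OF V_psd])
  then show ?thesis
    unfolding residual_trace_msqrt
    using linear_diff[OF linear_matrix_mult2[of "msqrt V" "msqrt V"], of "(mean_compression V ^^ n) (mat 1)" "(mean_compression V ^^ Suc n) (mat 1)"]
    by (simp add: trace_sub del: funpow.simps)
qed

lemma sum_residual_trace_le: "(\<Sum>j\<le>n. residual_trace V j) \<le> (real CARD('d))\<^sup>2"
proof -
  let ?b = "\<lambda>n. trace ((mean_compression V ^^ n) (mat 1))"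
  have "residual_trace V j = real CARD('d) * (?b j - ?b (Suc j))" for j
  proof -
    \<comment> \<open>Self-adjointness moves the iterate from \<open>mat 1\<close> onto
      \<open>V\<close>, where it is \<open>real CARD('d)\<close> times the decrement.\<close>
    have "residual_trace V j = trace ((mean_compression V ^^ j) V)"
      using trace_mean_compression_funpow_adjoint[where V = V and n = j and A = V and B = "mat 1"] by (simp add: residual_trace_def)
    moreover have "?b j - ?b (Suc j) = (1 / real CARD('d)) * trace ((mean_compression V ^^ j) V)"
      unfolding trace_sub[symmetric] mean_compression_decrement trace_scaleR ..
    ultimately show ?thesis by simp
  qed
  then have "(\<Sum>j\<le>n. residual_trace V j) = real CARD('d) * (\<Sum>j\<le>n. ?b j - ?b (Suc j))"
    by (simp add: sum_distrib_left)
  also have "\<dots> = real CARD('d) * (?b 0 - ?b (Suc n))"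
    by (subst sum_telescope) simp
  \<comment> \<open>The final trace is non-negative and is dropped; the initial one is the trace of
    the identity, which supplies the second factor \<open>real CARD('d)\<close>.\<close>
  also have "\<dots> \<le> real CARD('d) * ?b 0"
    using trace_psd_nonneg[OF psd_mean_compression_funpow[OF psd_matrix_mat_1, where V = V and n = "Suc n"]]
    by (intro mult_left_mono) auto
  also have "?b 0 = real CARD('d)" by (simp add: trace_I)
  finally show ?thesis by (simp add: power2_eq_square)
qed

text \<open>By monotonicity each of the \<open>n + 1\<close> terms of the sum is at least the last
  one. Since that one is non-negative, the factor \<open>n + 1\<close> may be weakened to
  \<open>n\<close>.\<close>

lemma residual_trace_le:
  assumes "n \<ge> 1"
  shows "residual_trace V n \<le> (real CARD('d))\<^sup>2 / real n"
proof -
  have "residual_trace V n \<le> residual_trace V j" if "j \<le> n" for j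
    using that by (induction rule: dec_induct) (auto intro: order_trans[OF residual_trace_antimono_Suc])
  then have "real (Suc n) * residual_trace V n \<le> (\<Sum>j\<le>n. residual_trace V j)"
    using sum_bounded_below[of "{..n}" "residual_trace V n" "residual_trace V"] by simp
  moreover have "0 \<le> residual_trace V n"
    unfolding residual_trace_msqrt
    by (intro trace_psd_nonneg psd_matrix_congruence psd_mean_compression_funpow psd_matrix_mat_1 transpose_msqrt[OF V_psd])
  ultimately have "real n * residual_trace V n \<le> (real CARD('d))\<^sup>2"
    using sum_residual_trace_le[of n] by (simp add: algebra_simps)
  then show ?thesis using assms by (simp add: field_simps)
qed

end

subsection \<open>The Gibbs sampler\<close>

text \<open>The chain in whitened coordinates. The free starting point \<open>y\<close> allows
  several copies to be driven by the same indices and the same noise.\<close>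

primrec Yseq :: "real^'d^'d \<Rightarrow> (nat \<Rightarrow> 'd) \<Rightarrow> (nat \<Rightarrow> real) \<Rightarrow> real^'d \<Rightarrow> nat \<Rightarrow> real^'d" where
  "Yseq V ii gg y 0 = y"
| "Yseq V ii gg y (Suc n) = Pmat V (ii n) *v Yseq V ii gg y n + gg n *\<^sub>R fvec V (ii n)"

text \<open>With \<open>f = fvec V k\<close>, both \<open>V *v axis k 1 = msqrt V *v f\<close> and
  \<open>axis k 1 \<bullet> (msqrt V *v y) = f \<bullet> y\<close> hold, so \<open>msqrt V\<close>
  factors out of the update.\<close>

lemma Xseq_eq_msqrt_Yseq:
  assumes V: "psd_matrix V"
  shows "Xseq V ii gg n = msqrt V *v Yseq V ii gg 0 n"
proof (induction n)
  case (Suc n)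
  have sym: "transpose (msqrt V) = msqrt V" by (rule transpose_msqrt[OF V])
  let ?y = "Yseq V ii gg 0 n" and ?f = "fvec V (ii n)"
  have "V *v axis (ii n) 1 = msqrt V *v ?f"
    by (simp add: fvec_def matrix_vector_mul_assoc msqrt_square[OF V])
  moreover have "axis (ii n) 1 \<bullet> (msqrt V *v ?y) = ?f \<bullet> ?y"
    by (simp add: fvec_def inner_symmetric_matrix[OF sym])
  ultimately show ?case
    by (simp add: Suc Pmat_mult_vec scalar_mult_eq_scaleR matrix_vector_right_distrib
        matrix_vector_mult_diff_distrib matrix_vector_mult_scaleR scaleR_diff_left)
qed simp

lemma (in prob_space) std_normal_moments:
  assumes X: "distributed M lborel X std_normal_density"
  shows "integrable M X" "expectation X = 0" "integrable M (\<lambda>\<omega>. X \<omega> * X \<omega>)" "(\<integral>\<omega>. X \<omega> * X \<omega> \<partial>M) = 1"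
proof -
  show "expectation X = 0" by (rule standard_normal_distributed_expectation[OF X])
  show "integrable M X"
    using distributed_integrable[OF X, of "\<lambda>x. x"] integrable_std_normal_moment[of 1] by simp
  show "integrable M (\<lambda>\<omega>. X \<omega> * X \<omega>)"
    using distributed_integrable[OF X, of "\<lambda>x. x * x"] integrable_std_normal_moment[of 2]
    by (simp add: power2_eq_square)
  show "(\<integral>\<omega>. X \<omega> * X \<omega> \<partial>M) = 1"
    using distributed_integral[OF X, of "\<lambda>x. x * x"] integral_std_normal_moment_even[of 1]
    by (simp add: power2_eq_square)
qed

text \<open>Needed since the matrix of each step is selected by a random index; measurability for
  each fixed index value suffices.\<close>

lemma measurable_case_finite:
  fixes f :: "'d::finite \<Rightarrow> 'a \<Rightarrow> 'b"
  assumes "\<And>k. f k \<in> measurable N S" "j \<in> measurable N (count_space UNIV)"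
  shows "(\<lambda>\<omega>. f (j \<omega>) \<omega>) \<in> measurable N S"
  by (rule measurable_compose_countable'[OF assms countable_finite[OF finite]])

text \<open>The sum type treats every index, every noise variable and every coordinate of
  \<open>Z0\<close> as a separate source of randomness, so one family expresses their joint
  independence.\<close>

locale gibbs_chain = prob_space M
  for M :: "'a measure" +
  fixes V :: "real^'d^'d"
    and i :: "nat \<Rightarrow> 'a \<Rightarrow> 'd"
    and g :: "nat \<Rightarrow> 'a \<Rightarrow> real"
    and Z0 :: "'a \<Rightarrow> real^'d"
  assumes V_psd: "psd_matrix V"
    and V_diag: "\<And>k. V $ k $ k = 1"
    and i_meas: "\<And>n. i n \<in> measurable M (count_space UNIV)"
    and i_unif: "\<And>n k. measure M {\<omega>\<in>space M. i n \<omega> = k} = 1 / real CARD('d)"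
    and g_gauss: "\<And>n. distributed M lborel (g n) std_normal_density"
    and Z0_gauss: "\<And>k. distributed M lborel (\<lambda>\<omega>. Z0 \<omega> $ k) std_normal_density"
    and indep: "indep_sets
       (\<lambda>j. case j of
              Inl n \<Rightarrow> sets (vimage_algebra (space M) (i n) (count_space UNIV))
            | Inr (Inl n) \<Rightarrow> sets (vimage_algebra (space M) (g n) borel)
            | Inr (Inr k) \<Rightarrow> sets (vimage_algebra (space M) (\<lambda>\<omega>. Z0 \<omega> $ k) borel))
       (UNIV :: (nat + nat + 'd) set)"
begin

section \<open>Sources of randomness, the sigma-algebras they generate, and adaptedness\<close>

definition block :: "nat + nat + 'd \<Rightarrow> 'a set set" where
  "block = (\<lambda>j. case j of
              Inl n \<Rightarrow> sets (vimage_algebra (space M) (i n) (count_space UNIV))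
            | Inr (Inl n) \<Rightarrow> sets (vimage_algebra (space M) (g n) borel)
            | Inr (Inr k) \<Rightarrow> sets (vimage_algebra (space M) (\<lambda>\<omega>. Z0 \<omega> $ k) borel))"

text \<open>The information carried by the sources in \<open>J\<close>, as a measurable space on
  which measurability can be stated; its measure is of no concern.\<close>

definition info :: "(nat + nat + 'd) set \<Rightarrow> 'a measure" where
  "info J = sigma (space M) (\<Union>j\<in>J. block j)"

text \<open>The sources that can have influenced the chain before step \<open>n\<close> is taken:
  all of \<open>Z0\<close>, and the indices and noise variables numbered below
  \<open>n\<close>.\<close>

definition past :: "nat \<Rightarrow> (nat + nat + 'd) set" where
  "past n = Inl ` {..<n} \<union> (Inr \<circ> Inl) ` {..<n} \<union> range (Inr \<circ> Inr)"

lemma indep_block: "indep_sets block UNIV"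
  using indep by (simp add: block_def)

lemma block_events: "block j \<subseteq> events"
  using indep_block by (auto simp: indep_sets_def)

lemma Int_stable_block: "Int_stable (block j)"
  by (auto simp: block_def Int_stable_def split: sum.split)

lemma space_info [simp]: "space (info J) = space M"
  by (simp add: info_def space_measure_of_conv)

lemma sets_info: "sets (info J) = sigma_sets (space M) (\<Union>j\<in>J. block j)"
  unfolding info_def using block_events sets.space_closed[of M]
  by (intro sets_measure_of) blast

lemma info_events: "sets (info J) \<subseteq> events"
  unfolding sets_info using block_events by (intro sets.sigma_sets_subset) auto

lemma info_mono: "J \<subseteq> K \<Longrightarrow> sets (info J) \<subseteq> sets (info K)"
  unfolding sets_info by (intro sigma_sets_mono') auto

lemma measurable_info_mono: "X \<in> measurable (info J) S \<Longrightarrow> J \<subseteq> K \<Longrightarrow> X \<in> measurable (info K) S"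
  by (rule subsetD[OF measurable_mono]) (simp_all add: info_mono)

lemma measurable_info: "X \<in> measurable (info J) S \<Longrightarrow> X \<in> measurable M S"
  by (rule subsetD[OF measurable_mono]) (simp_all add: info_events)

lemma block_info: "j \<in> J \<Longrightarrow> block j \<subseteq> sets (info J)"
  unfolding sets_info by (auto intro: sigma_sets.Basic)

lemma info_i: "Inl n \<in> J \<Longrightarrow> i n \<in> measurable (info J) (count_space UNIV)"
  using block_info[of "Inl n" J] by (simp add: measurable_iff_sets block_def)

lemma info_g: "Inr (Inl n) \<in> J \<Longrightarrow> g n \<in> borel_measurable (info J)"
  using block_info[of "Inr (Inl n)" J] by (simp add: measurable_iff_sets block_def)

lemma info_Z0_nth: "Inr (Inr k) \<in> J \<Longrightarrow> (\<lambda>\<omega>. Z0 \<omega> $ k) \<in> borel_measurable (info J)"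
  using block_info[of "Inr (Inr k)" J] by (simp add: measurable_iff_sets block_def)

lemma info_Z0:
  assumes "range (Inr \<circ> Inr) \<subseteq> J"
  shows "Z0 \<in> borel_measurable (info J)"
proof -
  have "(\<lambda>\<omega>. Z0 \<omega> $ k) \<in> borel_measurable (info J)" for k
    using assms by (intro info_Z0_nth) auto
  from borel_measurable_vec_lambda[where f = "\<lambda>\<omega> k. Z0 \<omega> $ k", OF this] show ?thesis by simp
qed

lemma indep_info: "J \<inter> K = {} \<Longrightarrow> indep_set (sets (info J)) (sets (info K))"
  unfolding sets_info by (rule indep_set_blocks[OF indep_block Int_stable_block])

lemma info_indep_var:
  assumes "X \<in> measurable (info J) S" "Y \<in> measurable (info K) T" "J \<inter> K = {}"
  shows "indep_var S X T Y"
  by (rule indep_set_indep_var[OF indep_info[OF assms(3)] assms(1,2)]) (simp_all add: info_events)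

lemma past_Suc: "past n \<subseteq> past (Suc n)" "Inl n \<in> past (Suc n)" "Inr (Inl n) \<in> past (Suc n)"
  by (auto simp: past_def)

lemma past_disjoint: "{Inl n, Inr (Inl n)} \<inter> past n = {}" "{Inr (Inl n)} \<inter> past n = {}"
  "{Inl n} \<inter> (past n \<union> {Inr (Inl n)}) = {}"
  by (auto simp: past_def)

abbreviation Y :: "real^'d \<Rightarrow> nat \<Rightarrow> 'a \<Rightarrow> real^'d" where
  "Y y n \<omega> \<equiv> Yseq V (\<lambda>m. i m \<omega>) (\<lambda>m. g m \<omega>) y n"

text \<open>Adaptedness of the chain, for a start that is either constant or \<open>Z0\<close>: the
  step at time \<open>n\<close> adds only the index and the noise with number
  \<open>n\<close>.\<close>

lemma measurable_Yseq:
  assumes "y \<in> borel_measurable (info (past 0))"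
  shows "(\<lambda>\<omega>. Y (y \<omega>) n \<omega>) \<in> borel_measurable (info (past n))"
proof (induction n)
  case (Suc n)
  have [measurable]: "g n \<in> borel_measurable (info (past (Suc n)))"
    by (intro info_g past_Suc)
  have [measurable]: "(\<lambda>\<omega>. Y (y \<omega>) n \<omega>) \<in> borel_measurable (info (past (Suc n)))"
    by (rule measurable_info_mono[OF Suc past_Suc(1)])
  have "(\<lambda>\<omega>. Pmat V k *v Y (y \<omega>) n \<omega> + g n \<omega> *\<^sub>R fvec V k) \<in> borel_measurable (info (past (Suc n)))" for k
    unfolding Pmat_mult_vec by measurable
  from measurable_case_finite[OF this info_i[OF past_Suc(2)]] show ?case by simp
qed (use assms in simp)

text \<open>Splitting by the value of the index leaves, for each \<open>k\<close>, a real weight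
  built from fresh sources times a quantity from the past. Independence separates the two
  expectations, and the linear \<open>L k\<close> commutes with the integral. It is applied with
  \<psi> constant, linear and quadratic.\<close>

lemma expectation_step:
  fixes A :: "'a \<Rightarrow> 'b::euclidean_space" and L :: "'d \<Rightarrow> 'b \<Rightarrow> 'c::euclidean_space"
  assumes A_meas: "A \<in> borel_measurable (info (past n))" and A: "integrable M A"
    and L: "\<And>k. linear (L k)"
    and [measurable]: "\<psi> \<in> borel_measurable borel" and \<psi>: "integrable M (\<lambda>\<omega>. \<psi> (g n \<omega>))"
  shows "integrable M (\<lambda>\<omega>. \<psi> (g n \<omega>) *\<^sub>R L (i n \<omega>) (A \<omega>))"
    and "(\<integral>\<omega>. \<psi> (g n \<omega>) *\<^sub>R L (i n \<omega>) (A \<omega>) \<partial>M)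
      = (\<integral>\<omega>. \<psi> (g n \<omega>) \<partial>M) *\<^sub>R ((1 / real CARD('d)) *\<^sub>R (\<Sum>k\<in>UNIV. L k (\<integral>\<omega>. A \<omega> \<partial>M)))"
proof -
  note [measurable] = i_meas
  define I where "I k \<omega> = (indicator {k} (i n \<omega>) :: real)" for k \<omega>
  \<comment> \<open>The weight depends on \<open>i n\<close> and \<open>g n\<close> alone, hence is
    independent of \<open>A\<close>.\<close>
  define \<phi> where "\<phi> k \<omega> = I k \<omega> * \<psi> (g n \<omega>)" for k \<omega>
  have I_meas: "I k \<in> borel_measurable (info J)" if "Inl n \<in> J" for k J
    using info_i[OF that] unfolding I_def by measurable
  have \<psi>_meas: "(\<lambda>\<omega>. \<psi> (g n \<omega>)) \<in> borel_measurable (info J)" if "Inr (Inl n) \<in> J" for J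
    using info_g[OF that] by measurable
  have I: "integrable M (I k)" "(\<integral>\<omega>. I k \<omega> \<partial>M) = 1 / real CARD('d)" for k
  proof -
    have *: "I k \<omega> = indicator {\<omega>\<in>space M. i n \<omega> = k} \<omega>" if "\<omega> \<in> space M" for \<omega>
      using that by (simp add: I_def indicator_def)
    have "{\<omega>\<in>space M. i n \<omega> = k} \<in> events" by measurable
    then show "integrable M (I k)" "(\<integral>\<omega>. I k \<omega> \<partial>M) = 1 / real CARD('d)"
      using i_unif[of n k]
      by (simp_all add: * Bochner_Integration.integrable_cong[OF refl *] Bochner_Integration.integral_cong[OF refl *]
            emeasure_eq_measure)
  qed
  have ind: "indep_var borel (I k) borel (\<lambda>\<omega>. \<psi> (g n \<omega>))" for k
    by (rule info_indep_var[where J="{Inl n}" and K="{Inr (Inl n)}"]) (auto intro: I_meas \<psi>_meas)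
  have \<phi>: "integrable M (\<phi> k)" "(\<integral>\<omega>. \<phi> k \<omega> \<partial>M) = (1 / real CARD('d)) * (\<integral>\<omega>. \<psi> (g n \<omega>) \<partial>M)" for k
    using indep_var_integrable[OF ind I(1) \<psi>] indep_var_lebesgue_integral[OF ind I(1) \<psi>] I(2)
    by (simp_all add: \<phi>_def[abs_def])
  have ind2: "indep_var borel (\<phi> k) borel (\<lambda>\<omega>. A \<omega> \<bullet> b)" for k b
  proof (rule info_indep_var[OF _ _ past_disjoint(1)])
    show "\<phi> k \<in> borel_measurable (info {Inl n, Inr (Inl n)})"
      unfolding \<phi>_def by (intro borel_measurable_times I_meas \<psi>_meas) auto
    show "(\<lambda>\<omega>. A \<omega> \<bullet> b) \<in> borel_measurable (info (past n))"
      using A_meas by measurable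
  qed
  note \<phi>A = indep_scaleR[OF prob_space_axioms ind2 \<phi>(1) A]
  note L\<phi>A = integral_linear[OF L \<phi>A(1)]
  \<comment> \<open>For each outcome exactly one summand survives, the one whose \<open>k\<close> is
    the index drawn.\<close>
  have eq: "\<psi> (g n \<omega>) *\<^sub>R L (i n \<omega>) (A \<omega>) = (\<Sum>k\<in>UNIV. L k (\<phi> k \<omega> *\<^sub>R A \<omega>))" for \<omega>
  proof -
    have "(\<Sum>k\<in>UNIV. L k (\<phi> k \<omega> *\<^sub>R A \<omega>)) = (\<Sum>k\<in>UNIV. if k = i n \<omega> then \<psi> (g n \<omega>) *\<^sub>R L k (A \<omega>) else 0)"
      by (intro sum.cong refl) (auto simp: \<phi>_def I_def linear_scale[OF L] indicator_def)
    then show ?thesis by simp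
  qed
  show "integrable M (\<lambda>\<omega>. \<psi> (g n \<omega>) *\<^sub>R L (i n \<omega>) (A \<omega>))"
    unfolding eq using L\<phi>A(1) by (intro Bochner_Integration.integrable_sum)
  show "(\<integral>\<omega>. \<psi> (g n \<omega>) *\<^sub>R L (i n \<omega>) (A \<omega>) \<partial>M)
      = (\<integral>\<omega>. \<psi> (g n \<omega>) \<partial>M) *\<^sub>R ((1 / real CARD('d)) *\<^sub>R (\<Sum>k\<in>UNIV. L k (\<integral>\<omega>. A \<omega> \<partial>M)))"
  proof -
    have "(\<integral>\<omega>. (\<Sum>k\<in>UNIV. L k (\<phi> k \<omega> *\<^sub>R A \<omega>)) \<partial>M)
        = (\<Sum>k\<in>UNIV. L k (((1 / real CARD('d)) * (\<integral>\<omega>. \<psi> (g n \<omega>) \<partial>M)) *\<^sub>R (\<integral>\<omega>. A \<omega> \<partial>M)))"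
      using L\<phi>A(1) by (subst Bochner_Integration.integral_sum) (simp_all only: L\<phi>A(2) \<phi>A(2) \<phi>(2))
    then show ?thesis
      unfolding eq by (simp add: linear_scale[OF L] scaleR_sum_right)
  qed
qed

section \<open>The chain started from \<open>Z0\<close> is stationary\<close>

lemma indep_vars_Z0:
  "indep_vars (\<lambda>_. borel) (\<lambda>k \<omega>. Z0 \<omega> $ k) (UNIV :: 'd set)"
proof -
  have "indep_sets (\<lambda>k. sigma_sets (space M) (\<Union>j\<in>{Inr (Inr k)}. block j)) (UNIV :: 'd set)"
  proof (rule indep_sets_collect_sigma)
    show "indep_sets block (\<Union>k::'d\<in>UNIV. {Inr (Inr k)})"
      by (rule indep_sets_mono_index[OF subset_UNIV indep_block])
    show "disjoint_family_on (\<lambda>k::'d. {Inr (Inr k) :: nat + nat + 'd}) UNIV"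
      by (simp add: disjoint_family_on_def)
  qed (rule Int_stable_block)
  then have "indep_sets (\<lambda>k. sigma_sets (space M) {(\<lambda>\<omega>. Z0 \<omega> $ k) -` A \<inter> space M |A. A \<in> sets borel}) (UNIV :: 'd set)"
  proof (rule indep_sets_mono_sets)
    fix k :: 'd
    have "{(\<lambda>\<omega>. Z0 \<omega> $ k) -` A \<inter> space M |A. A \<in> sets borel} \<subseteq> block (Inr (Inr k))"
      by (auto simp: block_def sets_vimage_algebra intro: sigma_sets.Basic)
    then show "sigma_sets (space M) {(\<lambda>\<omega>. Z0 \<omega> $ k) -` A \<inter> space M |A. A \<in> sets borel}
      \<subseteq> sigma_sets (space M) (\<Union>j\<in>{Inr (Inr k)}. block j)"
      by (intro sigma_sets_mono') simp
  qed
  moreover have "(\<lambda>\<omega>. Z0 \<omega> $ k) \<in> borel_measurable M" for k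
    using distributed_measurable[OF Z0_gauss] by simp
  ultimately show ?thesis unfolding indep_vars_def by simp
qed

lemma distr_std_normal:
  assumes "distributed M lborel X std_normal_density"
  shows "distr M borel X = std_normal"
proof -
  have "distr M borel X = distr M lborel X" by (rule distr_cong) simp_all
  then show ?thesis using assms by (simp add: distributed_def)
qed

lemma measurable_Z0: "Z0 \<in> borel_measurable (info (past 0))"
  by (rule info_Z0) (simp add: past_def)

lemma distr_Z0: "distr M borel Z0 = std_gaussian"
proof -
  have Z: "(\<lambda>\<omega>. Z0 \<omega> $ k) \<in> borel_measurable M" for k
    using distributed_measurable[OF Z0_gauss] by simp
  let ?P = "\<Pi>\<^sub>M k\<in>(UNIV::'d set). (borel :: real measure)"
  have m: "(\<lambda>\<omega>. \<lambda>k\<in>UNIV. Z0 \<omega> $ k) \<in> measurable M ?P"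
    using Z by (intro measurable_restrict) auto
  have v: "(\<lambda>z. \<chi> k. z k) \<in> borel_measurable ?P"
    by (rule measurable_vec_lambda) simp
  have "distr M borel Z0 = distr M borel ((\<lambda>z. \<chi> k. z k) \<circ> (\<lambda>\<omega>. \<lambda>k\<in>UNIV. Z0 \<omega> $ k))"
    by (simp add: comp_def restrict_def)
  also have "\<dots> = distr (distr M ?P (\<lambda>\<omega>. \<lambda>k\<in>UNIV. Z0 \<omega> $ k)) borel (\<lambda>z. \<chi> k. z k)"
    by (rule distr_distr[OF v m, symmetric])
  also have "distr M ?P (\<lambda>\<omega>. \<lambda>k\<in>UNIV. Z0 \<omega> $ k) = (\<Pi>\<^sub>M k\<in>UNIV. distr M borel (\<lambda>\<omega>. Z0 \<omega> $ k))"
    using indep_vars_iff_distr_eq_PiM[of UNIV "\<lambda>k \<omega>. Z0 \<omega> $ k" "\<lambda>_. borel"] Z indep_vars_Z0 by simp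
  also have "(\<lambda>k. distr M borel (\<lambda>\<omega>. Z0 \<omega> $ k)) = (\<lambda>k. std_normal)"
    using distr_std_normal[OF Z0_gauss] by (intro ext)
  finally show ?thesis by (simp add: std_gaussian_def)
qed

text \<open>For each fixed index value the step resamples one direction and preserves the Gaussian
  law; the actual step is a mixture of these, with an index independent of the candidate
  states.\<close>

lemma distr_Y_Z0: "distr M borel (\<lambda>\<omega>. Y (Z0 \<omega>) n \<omega>) = std_gaussian"
proof (induction n)
  case 0
  then show ?case by (simp add: distr_Z0)
next
  case (Suc n)
  let ?W = "\<lambda>\<omega>. Y (Z0 \<omega>) n \<omega>"
  \<comment> \<open>The state that would follow if the index were \<open>k\<close>, defined for
    every outcome and independent of \<open>i n\<close>.\<close>
  define U where "U k \<omega> = ?W \<omega> - (fvec V k \<bullet> ?W \<omega>) *\<^sub>R fvec V k + g n \<omega> *\<^sub>R fvec V k" for k \<omega>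
  have W: "?W \<in> borel_measurable (info (past n))" by (rule measurable_Yseq[OF measurable_Z0])
  have gn: "g n \<in> borel_measurable (info {Inr (Inl n)})" by (rule info_g) simp
  have [measurable]: "?W \<in> borel_measurable M" "g n \<in> borel_measurable M"
    using W gn by (auto intro: measurable_info)
  have U: "U k \<in> borel_measurable (info (past n \<union> {Inr (Inl n)}))" for k
  proof -
    have [measurable]: "?W \<in> borel_measurable (info (past n \<union> {Inr (Inl n)}))"
        "g n \<in> borel_measurable (info (past n \<union> {Inr (Inl n)}))"
      using W gn by (auto intro: measurable_info_mono)
    show ?thesis unfolding U_def by measurable
  qed
  have dU: "distr M borel (U k) = std_gaussian" for k
  proof -
    have gn': "g n \<in> measurable (info {Inr (Inl n)}) std_normal" using gn by simp
    \<comment> \<open>The current state and the fresh noise are independent, so their joint law is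
      the product measure to which the resampling lemma applies.\<close>
    have "distr M (borel \<Otimes>\<^sub>M std_normal) (\<lambda>\<omega>. (?W \<omega>, g n \<omega>)) = distr M borel ?W \<Otimes>\<^sub>M distr M std_normal (g n)"
      using indep_info[of "past n" "{Inr (Inl n)}"] past_disjoint(2)[of n]
      by (intro indep_set_distr_pair[OF _ W gn'] info_events space_info) blast
    also have "distr M std_normal (g n) = std_normal"
      using distr_std_normal[OF g_gauss[of n]] distr_cong[of M M std_normal borel "g n" "g n"] by simp
    finally have "distr M (borel \<Otimes>\<^sub>M std_normal) (\<lambda>\<omega>. (?W \<omega>, g n \<omega>)) = std_gaussian \<Otimes>\<^sub>M std_normal"
      by (simp add: Suc)
    then have "distr (distr M (borel \<Otimes>\<^sub>M std_normal) (\<lambda>\<omega>. (?W \<omega>, g n \<omega>))) borel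
        (\<lambda>(z, t). z - (fvec V k \<bullet> z) *\<^sub>R fvec V k + t *\<^sub>R fvec V k) = std_gaussian"
      by (simp only: std_gaussian_resample_direction[OF norm_fvec[OF V_psd V_diag]])
    then show ?thesis
      by (subst (asm) distr_distr) (simp_all add: comp_def U_def[abs_def])
  qed
  show ?case
  proof (rule measure_eqI)
    fix A assume "A \<in> sets (distr M borel (\<lambda>\<omega>. Y (Z0 \<omega>) (Suc n) \<omega>))"
    then have [measurable]: "A \<in> sets borel" by simp
    have [measurable]: "(\<lambda>\<omega>. Y (Z0 \<omega>) (Suc n) \<omega>) \<in> borel_measurable M" "U k \<in> borel_measurable M"
      "i n \<in> measurable M (count_space UNIV)" for k
      by (rule measurable_info[OF measurable_Yseq[OF measurable_Z0]] measurable_info[OF U] i_meas)+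
    interpret G: prob_space "std_gaussian :: (real^'d) measure" by (rule prob_space_std_gaussian)
    \<comment> \<open>The event is split by the index drawn; each piece has probability
      \<open>1 / real CARD('d)\<close> times the Gaussian probability of \<open>A\<close>.\<close>
    let ?E = "\<lambda>k. {\<omega>\<in>space M. i n \<omega> = k} \<inter> (U k -` A \<inter> space M)"
    have "(\<lambda>\<omega>. Y (Z0 \<omega>) (Suc n) \<omega>) -` A \<inter> space M = (\<Union>k\<in>UNIV. ?E k)"
      by (auto simp: U_def Pmat_mult_vec)
    moreover have "prob (\<Union>k\<in>UNIV. ?E k) = (\<Sum>k\<in>UNIV. prob (?E k))"
      by (intro finite_measure_finite_Union) (auto simp: disjoint_family_on_def)
    moreover have "prob (?E k) = 1 / real CARD('d) * G.prob A" for k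
    proof -
      have "{\<omega>\<in>space M. i n \<omega> = k} = i n -` {k} \<inter> space M" by auto
      then have "{\<omega>\<in>space M. i n \<omega> = k} \<in> sets (info {Inl n})"
        using measurable_sets[OF info_i[of n "{Inl n}"], of "{k}"] by simp
      moreover have "U k -` A \<inter> space M \<in> sets (info (past n \<union> {Inr (Inl n)}))"
        using measurable_sets[OF U, of A k] by simp
      ultimately have "prob (?E k) = prob {\<omega>\<in>space M. i n \<omega> = k} * prob (U k -` A \<inter> space M)"
        by (rule indep_setD[OF indep_info[OF past_disjoint(3)]])
      also have "prob (U k -` A \<inter> space M) = G.prob A"
        unfolding dU[of k, symmetric] by (simp add: measure_distr)
      finally show ?thesis by (simp add: i_unif)
    qed
    ultimately have "prob ((\<lambda>\<omega>. Y (Z0 \<omega>) (Suc n) \<omega>) -` A \<inter> space M) = G.prob A"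
      by simp
    then show "emeasure (distr M borel (\<lambda>\<omega>. Y (Z0 \<omega>) (Suc n) \<omega>)) A = emeasure std_gaussian A"
      by (simp only: emeasure_distr[OF \<open>(\<lambda>\<omega>. Y (Z0 \<omega>) (Suc n) \<omega>) \<in> borel_measurable M\<close> \<open>A \<in> sets borel\<close>]
          emeasure_eq_measure G.emeasure_eq_measure)
  qed simp
qed


section \<open>Means and second moments of the chains\<close>

lemma expectation_step_index:
  fixes A :: "'a \<Rightarrow> 'b::euclidean_space" and L :: "'d \<Rightarrow> 'b \<Rightarrow> 'c::euclidean_space"
  assumes A_meas: "A \<in> borel_measurable (info (past n))" and A: "integrable M A"
    and L: "\<And>k. linear (L k)"
  shows "integrable M (\<lambda>\<omega>. L (i n \<omega>) (A \<omega>))"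
    and "(\<integral>\<omega>. L (i n \<omega>) (A \<omega>) \<partial>M) = (1 / real CARD('d)) *\<^sub>R (\<Sum>k\<in>UNIV. L k (\<integral>\<omega>. A \<omega> \<partial>M))"
proof -
  have "(\<lambda>_. 1) \<in> borel_measurable (borel :: real measure)" "integrable M (\<lambda>\<omega>. 1 :: real)" by simp_all
  note step = expectation_step[where L = L and \<psi> = "\<lambda>_. 1", OF A_meas A L this]
  show "integrable M (\<lambda>\<omega>. L (i n \<omega>) (A \<omega>))" using step(1) by simp
  show "(\<integral>\<omega>. L (i n \<omega>) (A \<omega>) \<partial>M) = (1 / real CARD('d)) *\<^sub>R (\<Sum>k\<in>UNIV. L k (\<integral>\<omega>. A \<omega> \<partial>M))"
    using step(2) by (simp add: prob_space)
qed

text \<open>The general step with past quantity \<open>A = 1\<close> and \<open>L k\<close>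
  multiplying \<open>h k\<close> by a scalar.\<close>

lemma expectation_step_noise:
  fixes h :: "'d \<Rightarrow> 'c::euclidean_space"
  assumes "\<psi> \<in> borel_measurable borel" "integrable M (\<lambda>\<omega>. \<psi> (g n \<omega>))"
  shows "integrable M (\<lambda>\<omega>. \<psi> (g n \<omega>) *\<^sub>R h (i n \<omega>))"
    and "(\<integral>\<omega>. \<psi> (g n \<omega>) *\<^sub>R h (i n \<omega>) \<partial>M)
      = (\<integral>\<omega>. \<psi> (g n \<omega>) \<partial>M) *\<^sub>R ((1 / real CARD('d)) *\<^sub>R (\<Sum>k\<in>UNIV. h k))"
proof -
  have "linear (\<lambda>c::real. c *\<^sub>R h k)" for k by (simp add: linear_iff algebra_simps)
  then have lin: "\<And>k. linear ((\<lambda>k (c::real). c *\<^sub>R h k) k)" .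
  have "(\<lambda>_. 1 :: real) \<in> borel_measurable (info (past n))" "integrable M (\<lambda>\<omega>. 1 :: real)" by simp_all
  note step = expectation_step[OF this lin assms]
  show "integrable M (\<lambda>\<omega>. \<psi> (g n \<omega>) *\<^sub>R h (i n \<omega>))" using step(1) by simp
  show "(\<integral>\<omega>. \<psi> (g n \<omega>) *\<^sub>R h (i n \<omega>) \<partial>M)
      = (\<integral>\<omega>. \<psi> (g n \<omega>) \<partial>M) *\<^sub>R ((1 / real CARD('d)) *\<^sub>R (\<Sum>k\<in>UNIV. h k))"
    using step(2) by (simp add: prob_space)
qed

text \<open>The recursion shared by \<open>M ** transpose M\<close> for the random product
  \<open>M\<close> and by the second moment of the coupled difference: each step is a compression by
  the drawn projection, so the mean evolves under \<open>mean_compression V\<close>.\<close>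

lemma expectation_compressed:
  fixes Q :: "nat \<Rightarrow> 'a \<Rightarrow> real^'d^'d"
  assumes Q0: "Q 0 \<in> borel_measurable (info (past 0))" "integrable M (Q 0)" "(\<integral>\<omega>. Q 0 \<omega> \<partial>M) = mat 1"
    and Q_Suc: "\<And>n \<omega>. Q (Suc n) \<omega> = Pmat V (i n \<omega>) ** Q n \<omega> ** Pmat V (i n \<omega>)"
  shows "integrable M (Q n)" and "(\<integral>\<omega>. Q n \<omega> \<partial>M) = (mean_compression V ^^ n) (mat 1)"
proof -
  have Q_eq: "Q (Suc n) = (\<lambda>\<omega>. Pmat V (i n \<omega>) ** Q n \<omega> ** Pmat V (i n \<omega>))" for n
    by (rule ext) (rule Q_Suc)
  have "Q n \<in> borel_measurable (info (past n)) \<and> integrable M (Q n)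
      \<and> (\<integral>\<omega>. Q n \<omega> \<partial>M) = (mean_compression V ^^ n) (mat 1)"
  proof (induction n)
    case (Suc n)
    have "(\<lambda>\<omega>. Pmat V k ** Q n \<omega> ** Pmat V k) \<in> borel_measurable (info (past (Suc n)))" for k
    proof -
      have "Q n \<in> borel_measurable (info (past (Suc n)))"
        by (rule measurable_info_mono[OF conjunct1[OF Suc] past_Suc(1)])
      moreover have "(\<lambda>A. Pmat V k ** A ** Pmat V k) \<in> borel_measurable borel"
        by (rule borel_measurable_linear[OF linear_matrix_mult2])
      ultimately show ?thesis by (rule measurable_compose)
    qed
    from measurable_case_finite[OF this info_i[OF past_Suc(2)]]
    have "Q (Suc n) \<in> borel_measurable (info (past (Suc n)))" by (simp only: Q_eq)
    moreover have "integrable M (Q (Suc n))" "(\<integral>\<omega>. Q (Suc n) \<omega> \<partial>M) = mean_compression V (\<integral>\<omega>. Q n \<omega> \<partial>M)"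
      using expectation_step_index[where L = "\<lambda>k A. Pmat V k ** A ** Pmat V k",
        OF conjunct1[OF Suc] conjunct1[OF conjunct2[OF Suc]] linear_matrix_mult2]
      by (simp_all only: Q_Suc mean_compression_def Q_eq)
    ultimately show ?case using Suc by simp
  qed (use Q0 in simp)
  then show "integrable M (Q n)" "(\<integral>\<omega>. Q n \<omega> \<partial>M) = (mean_compression V ^^ n) (mat 1)"
    by blast+
qed

text \<open>Cyclicity rewrites the norm through \<open>M ** transpose M\<close>, on which a new
  factor \<open>Pmat\<close> acts from the outside; in \<open>transpose M ** V ** M\<close> it would
  land in the middle and give no closed recursion.\<close>

lemma expectation_mnorm2:
  "(\<integral>\<omega>. mnorm2 V (Mseq V (\<lambda>m. i m \<omega>) n) \<partial>M) = residual_trace V n"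
proof -
  let ?Q = "\<lambda>n \<omega>. Mseq V (\<lambda>m. i m \<omega>) n ** transpose (Mseq V (\<lambda>m. i m \<omega>) n)"
  have Q: "integrable M (?Q n)" "(\<integral>\<omega>. ?Q n \<omega> \<partial>M) = (mean_compression V ^^ n) (mat 1)"
  proof -
    have "?Q 0 = (\<lambda>_. mat 1)" by simp
    moreover have "?Q (Suc n) \<omega> = Pmat V (i n \<omega>) ** ?Q n \<omega> ** Pmat V (i n \<omega>)" for n \<omega>
      by (simp add: matrix_transpose_mul transpose_Pmat matrix_mul_assoc)
    ultimately show "integrable M (?Q n)" "(\<integral>\<omega>. ?Q n \<omega> \<partial>M) = (mean_compression V ^^ n) (mat 1)"
      using expectation_compressed[of ?Q n] by (simp_all add: prob_space)
  qed
  have "mnorm2 V A = trace (V ** (A ** transpose A))" for A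
    using trace_mul_sym[of "transpose A" "V ** A"] by (simp add: mnorm2_def matrix_mul_assoc)
  moreover have "linear (\<lambda>A. trace (V ** A))"
    by (simp add: linear_iff matrix_add_ldistrib matrix_mult_scaleR trace_add trace_scaleR)
  ultimately show ?thesis
    using integral_linear(2)[OF _ Q(1)] by (simp add: residual_trace_def Q(2))
qed

text \<open>Off the diagonal, independence and zero means give 0; on it stands the unit
  variance.\<close>

lemma integrable_outer_Z0: "integrable M (\<lambda>\<omega>. outer (Z0 \<omega>) (Z0 \<omega>))"
  and expectation_outer_Z0: "(\<integral>\<omega>. outer (Z0 \<omega>) (Z0 \<omega>) \<partial>M) = mat 1"
proof -
  have ind: "indep_var borel (\<lambda>\<omega>. Z0 \<omega> $ a) borel (\<lambda>\<omega>. Z0 \<omega> $ b)" if "a \<noteq> b" for a b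
    using that by (intro info_indep_var[where J="{Inr (Inr a)}" and K="{Inr (Inr b)}"] info_Z0_nth) auto
  note mom = std_normal_moments[OF Z0_gauss]
  have *: "integrable M (\<lambda>\<omega>. Z0 \<omega> $ a * Z0 \<omega> $ b) \<and>
      (\<integral>\<omega>. Z0 \<omega> $ a * Z0 \<omega> $ b \<partial>M) = (if a = b then 1 else 0)" for a b
    using mom[of a] mom[of b] indep_var_integrable[OF ind] indep_var_lebesgue_integral[OF ind]
    by (cases "a = b") auto
  show int: "integrable M (\<lambda>\<omega>. outer (Z0 \<omega>) (Z0 \<omega>))"
    using * by (simp add: integrable_vec_iff outer_def)
  then have "integrable M (\<lambda>\<omega>. outer (Z0 \<omega>) (Z0 \<omega>) $ a)" for a
    by (simp add: integrable_vec_iff)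
  with int show "(\<integral>\<omega>. outer (Z0 \<omega>) (Z0 \<omega>) \<partial>M) = mat 1"
    using * by (simp add: vec_eq_iff integral_vec_nth mat_def) (simp add: outer_def)
qed

lemma borel_measurable_outer:
  assumes "X \<in> borel_measurable N" "X' \<in> borel_measurable N"
  shows "(\<lambda>\<omega>. outer (X \<omega>) (X' \<omega>)) \<in> borel_measurable N"
  unfolding outer_def
  by (intro borel_measurable_vec_lambda borel_measurable_times
      measurable_compose[OF assms(1) borel_measurable_vec_nth]
      measurable_compose[OF assms(2) borel_measurable_vec_nth])

text \<open>The common noise cancels, so the difference of the two chains starts at
  \<open>Z0\<close> and is merely multiplied by the drawn projection in each step.\<close>

lemma expectation_outer_coupled_difference:
  fixes n
  defines "D \<equiv> \<lambda>\<omega>. Y (Z0 \<omega>) n \<omega> - Y 0 n \<omega>"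
  shows "integrable M (\<lambda>\<omega>. outer (D \<omega>) (D \<omega>))"
    and "(\<integral>\<omega>. outer (D \<omega>) (D \<omega>) \<partial>M) = (mean_compression V ^^ n) (mat 1)"
proof -
  let ?Q = "\<lambda>n \<omega>. outer (Y (Z0 \<omega>) n \<omega> - Y 0 n \<omega>) (Y (Z0 \<omega>) n \<omega> - Y 0 n \<omega>)"
  have "?Q (Suc n) \<omega> = Pmat V (i n \<omega>) ** ?Q n \<omega> ** Pmat V (i n \<omega>)" for n \<omega>
  proof -
    have "Y (Z0 \<omega>) (Suc n) \<omega> - Y 0 (Suc n) \<omega> = Pmat V (i n \<omega>) *v (Y (Z0 \<omega>) n \<omega> - Y 0 n \<omega>)"
      by (simp add: matrix_vector_mult_diff_distrib)
    then show ?thesis by (simp only: outer_matrix_mult transpose_Pmat)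
  qed
  moreover have "?Q 0 \<in> borel_measurable (info (past 0))" "integrable M (?Q 0)" "(\<integral>\<omega>. ?Q 0 \<omega> \<partial>M) = mat 1"
    using borel_measurable_outer[OF measurable_Z0 measurable_Z0]
    by (simp_all add: integrable_outer_Z0 expectation_outer_Z0)
  ultimately show "integrable M (\<lambda>\<omega>. outer (D \<omega>) (D \<omega>))"
    "(\<integral>\<omega>. outer (D \<omega>) (D \<omega>) \<partial>M) = (mean_compression V ^^ n) (mat 1)"
    unfolding D_def by (rule expectation_compressed[of ?Q, rotated 3]; assumption)+
qed

lemma measurable_Y_0: "(\<lambda>\<omega>. Y 0 n \<omega>) \<in> borel_measurable (info (past n))"
  by (rule measurable_Yseq) simp

lemma expectation_Y_0: "integrable M (Y 0 n)" "(\<integral>\<omega>. Y 0 n \<omega> \<partial>M) = 0"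
proof -
  have "integrable M (Y 0 n) \<and> (\<integral>\<omega>. Y 0 n \<omega> \<partial>M) = 0"
  proof (induction n)
    case (Suc n)
    note g = std_normal_moments[OF g_gauss[of n]]
    have 1: "integrable M (\<lambda>\<omega>. Pmat V (i n \<omega>) *v Y 0 n \<omega>)" "(\<integral>\<omega>. Pmat V (i n \<omega>) *v Y 0 n \<omega> \<partial>M) = 0"
      using expectation_step_index[where L = "\<lambda>k y. Pmat V k *v y", OF measurable_Y_0 _ matrix_vector_mul_linear] Suc
      by simp_all
    have 2: "integrable M (\<lambda>\<omega>. g n \<omega> *\<^sub>R fvec V (i n \<omega>))" "(\<integral>\<omega>. g n \<omega> *\<^sub>R fvec V (i n \<omega>) \<partial>M) = 0"
      using expectation_step_noise[where \<psi> = "\<lambda>t. t" and h = "fvec V"] g by simp_all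
    show ?case using 1 2 by simp
  qed simp
  then show "integrable M (Y 0 n)" "(\<integral>\<omega>. Y 0 n \<omega> \<partial>M) = 0" by auto
qed

text \<open>The new second moment splits into the compressed old one \<open>?A\<close>, cross terms
  \<open>?B\<close> linear in the noise, and the noise term \<open>?C\<close> with mean
  \<open>V / d\<close>.\<close>

lemma expectation_outer_Y_0: "integrable M (\<lambda>\<omega>. outer (Y 0 n \<omega>) (Y 0 n \<omega>))"
  "(\<integral>\<omega>. outer (Y 0 n \<omega>) (Y 0 n \<omega>) \<partial>M) = mat 1 - (mean_compression V ^^ n) (mat 1)"
proof -
  have "integrable M (\<lambda>\<omega>. outer (Y 0 n \<omega>) (Y 0 n \<omega>)) \<and>
    (\<integral>\<omega>. outer (Y 0 n \<omega>) (Y 0 n \<omega>) \<partial>M) = mat 1 - (mean_compression V ^^ n) (mat 1)"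
  proof (induction n)
    case 0
    have "outer 0 0 = (0 :: real^'d^'d)" by (simp add: outer_def vec_eq_iff)
    then show ?case by simp
  next
    case (Suc n)
    let ?Y = "Y 0 n" and ?f = "fvec V" and ?T = "mean_compression V"
    note g = std_normal_moments[OF g_gauss[of n]]
    let ?A = "\<lambda>\<omega>. Pmat V (i n \<omega>) ** outer (?Y \<omega>) (?Y \<omega>) ** Pmat V (i n \<omega>)"
    let ?B = "\<lambda>\<omega>. g n \<omega> *\<^sub>R (outer (Pmat V (i n \<omega>) *v ?Y \<omega>) (?f (i n \<omega>)) + outer (?f (i n \<omega>)) (Pmat V (i n \<omega>) *v ?Y \<omega>))"
    let ?C = "\<lambda>\<omega>. (g n \<omega> * g n \<omega>) *\<^sub>R outer (?f (i n \<omega>)) (?f (i n \<omega>))"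
    have A: "integrable M ?A" "(\<integral>\<omega>. ?A \<omega> \<partial>M) = ?T (mat 1 - (?T ^^ n) (mat 1))"
      using expectation_step_index[where L = "\<lambda>k A. Pmat V k ** A ** Pmat V k",
          OF borel_measurable_outer[OF measurable_Y_0 measurable_Y_0] conjunct1[OF Suc] linear_matrix_mult2]
      by (simp_all only: conjunct2[OF Suc] mean_compression_def[of V "mat 1 - (?T ^^ n) (mat 1)"])
    have lin: "linear (\<lambda>y. outer (Pmat V k *v y) (?f k) + outer (?f k) (Pmat V k *v y))" for k
      using linear_compose[OF matrix_vector_mul_linear outer_linear_left]
        linear_compose[OF matrix_vector_mul_linear outer_linear_right]
      by (intro linear_compose_add) (auto simp: comp_def)
    \<comment> \<open>The cross terms are linear in the past state and carry the factor
      \<open>g n\<close> of mean zero, so first moments of the state are enough.\<close>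
    have B: "integrable M ?B" "(\<integral>\<omega>. ?B \<omega> \<partial>M) = 0"
      using expectation_step[of ?Y n "\<lambda>k y. outer (Pmat V k *v y) (?f k) + outer (?f k) (Pmat V k *v y)" "\<lambda>t. t",
          OF measurable_Y_0 expectation_Y_0(1) lin] g
      by simp_all
    have C: "integrable M ?C" "(\<integral>\<omega>. ?C \<omega> \<partial>M) = (1 / real CARD('d)) *\<^sub>R V"
      using expectation_step_noise[where \<psi> = "\<lambda>t. t * t" and h = "\<lambda>k. outer (?f k) (?f k)"] g
      by (simp_all add: sum_outer_fvec[OF V_psd V_diag])
    have eq: "outer (Y 0 (Suc n) \<omega>) (Y 0 (Suc n) \<omega>) = ?A \<omega> + ?B \<omega> + ?C \<omega>" for \<omega>
    proof -
      have "?A \<omega> = outer (Pmat V (i n \<omega>) *v ?Y \<omega>) (Pmat V (i n \<omega>) *v ?Y \<omega>)"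
        by (simp add: outer_matrix_mult transpose_Pmat)
      then show ?thesis
        by (simp only:) (simp add: linear_add[OF outer_linear_left] linear_add[OF outer_linear_right]
          linear_scale[OF outer_linear_left] linear_scale[OF outer_linear_right] scaleR_add_right)
    qed
    have "(\<integral>\<omega>. outer (Y 0 (Suc n) \<omega>) (Y 0 (Suc n) \<omega>) \<partial>M)
        = ?T (mat 1 - (?T ^^ n) (mat 1)) + (1 / real CARD('d)) *\<^sub>R V"
      unfolding eq using A B C by simp
    \<comment> \<open>Here \<open>V / d\<close> is exactly what \<open>?T (mat 1)\<close> lacks to
      \<open>mat 1\<close>.\<close>
    also have "\<dots> = mat 1 - (?T ^^ Suc n) (mat 1)"
      by (simp add: linear_diff[OF linear_mean_compression] mean_compression_mat_1[OF V_psd V_diag])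
    finally show ?case
      unfolding eq using A(1) B(1) C(1) by simp
  qed
  then show "integrable M (\<lambda>\<omega>. outer (Y 0 n \<omega>) (Y 0 n \<omega>))"
    "(\<integral>\<omega>. outer (Y 0 n \<omega>) (Y 0 n \<omega>) \<partial>M) = mat 1 - (mean_compression V ^^ n) (mat 1)"
    by auto
qed

section \<open>Wasserstein distance and covariance of \<open>X\<close>\<close>

abbreviation X :: "nat \<Rightarrow> 'a \<Rightarrow> real^'d" where
  "X n \<omega> \<equiv> Xseq V (\<lambda>m. i m \<omega>) (\<lambda>m. g m \<omega>) n"

lemma borel_measurable_msqrt: "(\<lambda>x. msqrt V *v x) \<in> borel_measurable borel"
  by (rule borel_measurable_linear[OF matrix_vector_mul_linear])

lemma expectation_outer_msqrt:
  assumes "integrable M (\<lambda>\<omega>. outer (D \<omega>) (D \<omega>))"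
  shows "integrable M (\<lambda>\<omega>. outer (msqrt V *v D \<omega>) (msqrt V *v D \<omega>))"
    and "(\<integral>\<omega>. outer (msqrt V *v D \<omega>) (msqrt V *v D \<omega>) \<partial>M)
      = msqrt V ** (\<integral>\<omega>. outer (D \<omega>) (D \<omega>) \<partial>M) ** msqrt V"
  using integral_linear[OF linear_matrix_mult2[of "msqrt V" "msqrt V"] assms]
  by (simp_all add: outer_matrix_mult transpose_msqrt[OF V_psd])

lemma linear_trace: "linear (trace :: real^'d^'d \<Rightarrow> real)"
  by (simp add: linear_iff trace_add trace_scaleR)

text \<open>The coupling drives the chains from 0 and from \<open>Z0\<close> with the same indices
  and noise and maps both by \<open>msqrt V\<close>. The second marginal is Gaussian by
  stationarity, and the cost is the residual trace.\<close>

lemma wasserstein_X: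
  assumes n: "n \<ge> 1"
  shows "wasserstein2 (distr M borel (X n)) (gaussian_measure V) \<le> ennreal (real CARD('d) / sqrt (real n))"
proof -
  let ?W = "\<lambda>\<omega>. msqrt V *v Y (Z0 \<omega>) n \<omega>"
  let ?D = "\<lambda>\<omega>. Y (Z0 \<omega>) n \<omega> - Y 0 n \<omega>"
  let ?\<nu> = "distr M (borel \<Otimes>\<^sub>M borel) (\<lambda>\<omega>. (X n \<omega>, ?W \<omega>))"
  have X: "X n = (\<lambda>\<omega>. msqrt V *v Y 0 n \<omega>)"
    by (rule ext) (rule Xseq_eq_msqrt_Yseq[OF V_psd])
  have YZ: "(\<lambda>\<omega>. Y (Z0 \<omega>) n \<omega>) \<in> borel_measurable M"
    by (rule measurable_info[OF measurable_Yseq[OF measurable_Z0]])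
  have W: "?W \<in> borel_measurable M"
    by (rule measurable_compose[OF YZ borel_measurable_msqrt])
  have X_meas: "X n \<in> borel_measurable M"
    unfolding X by (rule measurable_compose[OF measurable_info[OF measurable_Y_0] borel_measurable_msqrt])
  have pair: "(\<lambda>\<omega>. (X n \<omega>, ?W \<omega>)) \<in> measurable M (borel \<Otimes>\<^sub>M borel)"
    by (rule measurable_Pair[OF X_meas W])
  have vec: "(\<lambda>z. \<chi> k. z k) \<in> borel_measurable (\<Pi>\<^sub>M k\<in>(UNIV::'d set). std_normal)"
    by (rule measurable_vec_lambda) simp
  have "distr M borel ?W = distr (distr M borel (\<lambda>\<omega>. Y (Z0 \<omega>) n \<omega>)) borel (\<lambda>x. msqrt V *v x)"
    by (subst distr_distr[OF borel_measurable_msqrt YZ]) (simp add: comp_def)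
  also have "\<dots> = gaussian_measure V"
    unfolding distr_Y_Z0 std_gaussian_def gaussian_measure_def
    by (subst distr_distr[OF borel_measurable_msqrt vec]) (simp add: comp_def)
  finally have W_law: "distr M borel ?W = gaussian_measure V" .
  have "?\<nu> \<in> couplings (distr M borel (X n)) (gaussian_measure V)"
    unfolding couplings_def W_law[symmetric]
    using pair by (simp add: prob_space_distr distr_distr comp_def)
  then have "(INF \<nu>\<in>couplings (distr M borel (X n)) (gaussian_measure V).
        \<integral>\<^sup>+ p. ennreal ((norm (fst p - snd p))\<^sup>2) \<partial>\<nu>)
      \<le> (\<integral>\<^sup>+ p. ennreal ((norm (fst p - snd p))\<^sup>2) \<partial>?\<nu>)" (is "?I \<le> _")
    by (rule INF_lower)
  also have "\<dots> = (\<integral>\<^sup>+ \<omega>. ennreal ((norm (X n \<omega> - ?W \<omega>))\<^sup>2) \<partial>M)"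
    using pair by (subst nn_integral_distr) simp_all
  \<comment> \<open>Writing the squared norm as the trace of an outer product makes the cost a
    linear function of the second moment matrix.\<close>
  also have "\<dots> = (\<integral>\<^sup>+ \<omega>. ennreal (trace (outer (msqrt V *v ?D \<omega>) (msqrt V *v ?D \<omega>))) \<partial>M)"
  proof (rule nn_integral_cong)
    fix \<omega>
    have "norm (X n \<omega> - ?W \<omega>) = norm (msqrt V *v ?D \<omega>)"
      by (simp add: Xseq_eq_msqrt_Yseq[OF V_psd] matrix_vector_mult_diff_distrib norm_minus_commute)
    then show "ennreal ((norm (X n \<omega> - ?W \<omega>))\<^sup>2) = ennreal (trace (outer (msqrt V *v ?D \<omega>) (msqrt V *v ?D \<omega>)))"
      by (simp add: trace_outer dot_square_norm)
  qed
  also have "\<dots> = ennreal (\<integral>\<omega>. trace (outer (msqrt V *v ?D \<omega>) (msqrt V *v ?D \<omega>)) \<partial>M)"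
    by (rule nn_integral_eq_integral)
       (rule integral_linear(1)[OF linear_trace
          expectation_outer_msqrt(1)[OF expectation_outer_coupled_difference(1)]], simp add: trace_outer)
  also have "(\<integral>\<omega>. trace (outer (msqrt V *v ?D \<omega>) (msqrt V *v ?D \<omega>)) \<partial>M) = residual_trace V n"
    by (simp only: integral_linear(2)[OF linear_trace
          expectation_outer_msqrt(1)[OF expectation_outer_coupled_difference(1)]]
        expectation_outer_msqrt(2)[OF expectation_outer_coupled_difference(1)]
        expectation_outer_coupled_difference(2) residual_trace_msqrt[OF V_psd V_diag])
  also have "ennreal (residual_trace V n) \<le> ennreal ((real CARD('d))\<^sup>2 / real n)"
    by (rule ennreal_leI[OF residual_trace_le[OF V_psd V_diag n]])
  finally have le: "?I \<le> ennreal ((real CARD('d))\<^sup>2 / real n)" .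
  \<comment> \<open>Finiteness selects the branch of \<open>ennsqrt\<close> that is an ordinary
    square root.\<close>
  then have "?I \<noteq> \<infinity>" by (metis ennreal_less_top infinity_ennreal_def leD)
  moreover have "sqrt (enn2real ?I) \<le> real CARD('d) / sqrt (real n)"
  proof -
    have "enn2real ?I \<le> (real CARD('d))\<^sup>2 / real n"
      using le by (intro enn2real_leI) auto
    then have "sqrt (enn2real ?I) \<le> sqrt ((real CARD('d))\<^sup>2 / real n)" by simp
    then show ?thesis by (simp add: real_sqrt_divide)
  qed
  ultimately show ?thesis
    unfolding wasserstein2_def ennsqrt_def by (simp only: if_False ennreal_leI)
qed

lemma expectation_X: "integrable M (\<lambda>\<omega>. X n \<omega> $ a)" "(\<integral>\<omega>. X n \<omega> $ a \<partial>M) = 0"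
proof -
  have X: "X n = (\<lambda>\<omega>. msqrt V *v Y 0 n \<omega>)"
    by (rule ext) (rule Xseq_eq_msqrt_Yseq[OF V_psd])
  note int = integral_linear[OF matrix_vector_mul_linear[of "msqrt V"] expectation_Y_0(1)[of n], folded X]
  show "integrable M (\<lambda>\<omega>. X n \<omega> $ a)" using int(1) by (simp add: integrable_vec_iff)
  show "(\<integral>\<omega>. X n \<omega> $ a \<partial>M) = 0"
    using integral_vec_nth[OF int(1), of a] int(2) by (simp add: expectation_Y_0(2))
qed

text \<open>Congruence by \<open>msqrt V\<close> of the second moment of \<open>Y 0 n\<close>; the
  identity part becomes \<open>V\<close>. What remains yields both the Loewner bound and the trace
  bound.\<close>

lemma integrable_X_product: "integrable M (\<lambda>\<omega>. X n \<omega> $ a * X n \<omega> $ b)"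
  and cov_X: "cov_mat M (X n) = V - msqrt V ** (mean_compression V ^^ n) (mat 1) ** msqrt V"
proof -
  have X: "X n \<omega> = msqrt V *v Y 0 n \<omega>" for \<omega> by (rule Xseq_eq_msqrt_Yseq[OF V_psd])
  note int = expectation_outer_msqrt[OF expectation_outer_Y_0(1)[of n], folded X]
  have int1: "integrable M (\<lambda>\<omega>. outer (X n \<omega>) (X n \<omega>) $ a)" for a
    using int(1) by (simp add: integrable_vec_iff)
  have int2: "integrable M (\<lambda>\<omega>. outer (X n \<omega>) (X n \<omega>) $ a $ b)" for a b
    using int1[of a] by (simp add: integrable_vec_iff)
  show "integrable M (\<lambda>\<omega>. X n \<omega> $ a * X n \<omega> $ b)"
    using int2[of a b] by (simp add: outer_def)
  have "cov_mat M (X n) = (\<integral>\<omega>. outer (X n \<omega>) (X n \<omega>) \<partial>M)"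
    by (simp add: vec_eq_iff cov_mat_def integral_vec_nth[OF int(1)] integral_vec_nth[OF int1])
       (simp add: outer_def)
  also have "\<dots> = msqrt V ** (mat 1 - (mean_compression V ^^ n) (mat 1)) ** msqrt V"
    by (simp only: int(2) expectation_outer_Y_0(2))
  also have "\<dots> = V - msqrt V ** (mean_compression V ^^ n) (mat 1) ** msqrt V"
    by (simp add: linear_diff[OF linear_matrix_mult2] msqrt_square[OF V_psd])
  finally show "cov_mat M (X n) = V - msqrt V ** (mean_compression V ^^ n) (mat 1) ** msqrt V" .
qed

lemma loewner_le_cov_X: "loewner_le (cov_mat M (X n)) V"
  unfolding loewner_le_def cov_X
  by (simp add: psd_matrix_congruence psd_mean_compression_funpow psd_matrix_mat_1 transpose_msqrt[OF V_psd])

lemma trace_cov_X: "trace (V - cov_mat M (X n)) = residual_trace V n"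
  by (simp add: cov_X residual_trace_msqrt[OF V_psd V_diag])

end

theorem theorem3p1:
  fixes M :: "'a measure"
    and V :: "real^'d^'d"
    and i :: "nat \<Rightarrow> 'a \<Rightarrow> 'd"
    and g :: "nat \<Rightarrow> 'a \<Rightarrow> real"
    and Z0 :: "'a \<Rightarrow> real^'d"
  assumes M: "prob_space M"
    and V_psd: "psd_matrix V"
    and V_diag: "\<forall>k. V $ k $ k = 1"
    and i_meas: "\<forall>n. i n \<in> measurable M (count_space UNIV)"
    and i_unif: "\<forall>n k. measure M {\<omega>\<in>space M. i n \<omega> = k} = 1 / real CARD('d)"
    and g_gauss: "\<forall>n. distributed M lborel (g n) std_normal_density"
    and Z0_gauss: "\<forall>k. distributed M lborel (\<lambda>\<omega>. Z0 \<omega> $ k) std_normal_density"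
    and indep: "prob_space.indep_sets M
       (\<lambda>j. case j of
              Inl n \<Rightarrow> sets (vimage_algebra (space M) (i n) (count_space UNIV))
            | Inr (Inl n) \<Rightarrow> sets (vimage_algebra (space M) (g n) borel)
            | Inr (Inr k) \<Rightarrow> sets (vimage_algebra (space M) (\<lambda>\<omega>. Z0 \<omega> $ k) borel))
       (UNIV :: (nat + nat + 'd) set)"
  defines "X \<equiv> \<lambda>n \<omega>. Xseq V (\<lambda>m. i m \<omega>) (\<lambda>m. g m \<omega>) n"
    and "Mn \<equiv> \<lambda>n \<omega>. Mseq V (\<lambda>m. i m \<omega>) n"
  shows "(\<forall>n\<ge>1. wasserstein2 (distr M borel (X n)) (gaussian_measure V)
                  \<le> ennreal (real CARD('d) / sqrt (real n)))
       \<and> (\<forall>n. (\<Sum>j\<le>n. integral\<^sup>L M (\<lambda>\<omega>. mnorm2 V (Mn j \<omega>))) \<le> (real CARD('d))\<^sup>2)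
       \<and> (\<forall>j. integral\<^sup>L M (\<lambda>\<omega>. mnorm2 V (Mn (Suc j) \<omega>)) \<le> integral\<^sup>L M (\<lambda>\<omega>. mnorm2 V (Mn j \<omega>)))
       \<and> (\<forall>n\<ge>1. (\<forall>a. integrable M (\<lambda>\<omega>. X n \<omega> $ a) \<and> integral\<^sup>L M (\<lambda>\<omega>. X n \<omega> $ a) = 0)
                \<and> (\<forall>a b. integrable M (\<lambda>\<omega>. X n \<omega> $ a * X n \<omega> $ b))
                \<and> loewner_le (cov_mat M (X n)) V
                \<and> trace (V - cov_mat M (X n)) \<le> (real CARD('d))\<^sup>2 / real n)"
proof -
  interpret gibbs_chain M V i g Z0
    by (intro gibbs_chain.intro gibbs_chain_axioms.intro M V_psd indep;
        simp add: V_diag i_meas i_unif g_gauss Z0_gauss)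
  show ?thesis
    unfolding X_def Mn_def
    using wasserstein_X expectation_mnorm2 sum_residual_trace_le[OF V_psd V_diag[rule_format]]
      residual_trace_antimono_Suc[OF V_psd V_diag[rule_format]]
      expectation_X integrable_X_product loewner_le_cov_X trace_cov_X
      residual_trace_le[OF V_psd V_diag[rule_format]]
    by (simp del: Mseq.simps)
qed

end
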